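(* Let $f\colon P\twoheadrightarrow Q$ be a surjective quandle homomorphism. Then the following conditions are equivalent. (i) The homomorphism $f$ is hypocentral, that is, $\mathrm{Inn}_{\mathrm{rel}}(f)$ is $\mathrm{Inn}(P)$-hypocentral. (ii) The group $\mathrm{Trans}_{\mathrm{rel}}(f)$ is $\mathrm{Inn}(P)$-hypocentral. (iii) The group $\mathrm{Adj}_{\mathrm{rel}}(f)$ is $\mathrm{Adj}(P)$-hypocentral. (iv) The group $\mathrm{Inn}_{\mathrm{rel}}(f)$ contains no non-trivial $\mathrm{Inn}(P)$-perfect normal subgroup of $\mathrm{Inn}(P)$.
   Context: A quandle is a set $Q$ with a map $s_x\colon Q\to Q$ for each $x\in Q$ such that, for all $x,y\in Q$, $s_x(x)=x$, $s_x$ is bijective, and $s_x\circ s_y=s_{s_x(y)}\circ s_x$. A quandle homomorphism is a map $f\colon P\to Q$ with $f\circ s_x=s_{f(x)}\circ f$ for all $x\in P$. The inner automorphism group $\mathrm{Inn}(Q)$ is the subgroup of $\mathrm{Aut}(Q)$ generated by all $s_x$. For a surjective quandle homomorphism $f\colon P\twoheadrightarrow Q$ there is a unique surjective group homomorphism $f_*\colon\mathrm{Inn}(P)\to\mathrm{Inn}(Q)$ with $f_*(s_x)=s_{f(x)}$; put $\mathrm{Inn}_{\mathrm{rel}}(f)=\mathrm{Ker}(f_* )$, and let $\mathrm{Trans}_{\mathrm{rel}}(f)=\langle s_xs_y^{-1}\mid x,y\in P,\ f(x)=f(y)\rangle$. Both are normal subgroups of $\mathrm{Inn}(P)$. The adjoint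 group $\mathrm{Adj}(Q)$ is the group generated by symbols $g_x$ ($x\in Q$) subject to the relations $g_xg_y=g_{s_x(y)}g_x$ for $x,y\in Q$. A quandle homomorphism $f\colon P\to Q$ induces $\mathrm{Adj}(f)\colon\mathrm{Adj}(P)\to\mathrm{Adj}(Q)$, $g_x\mapsto g_{f(x)}$; for $f$ surjective put $\mathrm{Adj}_{\mathrm{rel}}(f)=\mathrm{Ker}(\mathrm{Adj}(f))$. Commutators: $[x,y]=xyx^{-1}y^{-1}$, and $[A,B]$ is the subgroup generated by all $[a,b]$, $a\in A$, $b\in B$. For a normal subgroup $N\trianglelefteq G$, define for ordinals $\Gamma_0(G,N)=N$, $\Gamma_{\alpha+1}(G,N)=[G,\Gamma_\alpha(G,N)]$, and $\Gamma_\lambda(G,N)=\bigcap_{\alpha<\lambda}\Gamma_\alpha(G,N)$ for every non-zero limit ordinal $\lambda$. $N$ is $G$-hypocentral if $\Gamma_\alpha(G,N)=1$ for some ordinal $\alpha$. A normal subgroup $K\trianglelefteq G$ is $G$-perfect if $[G,K]=K$. *)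

theory Defs
  imports "HOL-Algebra.Generated_Groups" "HOL-Algebra.Bij"
begin

section \<open>Quandles\<close>

record 'a quandle = "'a partial_object" +
  symm :: "'a \<Rightarrow> 'a \<Rightarrow> 'a"

locale quandle =
  fixes Q :: "('a, 'm) quandle_scheme" (structure)
  assumes symm_self: "x \<in> carrier Q \<Longrightarrow> symm Q x x = x"
    and symm_bij: "x \<in> carrier Q \<Longrightarrow> bij_betw (symm Q x) (carrier Q) (carrier Q)"
    and symm_symm: "\<lbrakk>x \<in> carrier Q; y \<in> carrier Q; z \<in> carrier Q\<rbrakk>
      \<Longrightarrow> symm Q x (symm Q y z) = symm Q (symm Q x y) (symm Q x z)"

definition quandle_hom ::
    "('a, 'm) quandle_scheme \<Rightarrow> ('b, 'n) quandle_scheme \<Rightarrow> ('a \<Rightarrow> 'b) set" where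
  "quandle_hom P Q = {f \<in> carrier P \<rightarrow> carrier Q.
     \<forall>x\<in>carrier P. \<forall>y\<in>carrier P. f (symm P x y) = symm Q (f x) (f y)}"

definition quandle_epi ::
    "('a, 'm) quandle_scheme \<Rightarrow> ('b, 'n) quandle_scheme \<Rightarrow> ('a \<Rightarrow> 'b) set" where
  "quandle_epi P Q = {f \<in> quandle_hom P Q. f ` carrier P = carrier Q}"

definition quandle_auto :: "('a, 'm) quandle_scheme \<Rightarrow> ('a \<Rightarrow> 'a) set" where
  "quandle_auto Q = quandle_hom Q Q \<inter> Bij (carrier Q)"

definition Aut :: "('a, 'm) quandle_scheme \<Rightarrow> ('a \<Rightarrow> 'a) monoid" where
  "Aut Q = BijGroup (carrier Q) \<lparr>carrier := quandle_auto Q\<rparr>"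

text \<open>As in \<^const>\<open>BijGroup\<close>, permutations of the carrier are represented by functions
  that are \<^const>\<open>undefined\<close> outside it.\<close>

definition inner :: "('a, 'm) quandle_scheme \<Rightarrow> 'a \<Rightarrow> 'a \<Rightarrow> 'a" where
  "inner Q x = restrict (symm Q x) (carrier Q)"

definition Inn :: "('a, 'm) quandle_scheme \<Rightarrow> ('a \<Rightarrow> 'a) monoid" where
  "Inn Q = subgroup_generated (Aut Q) (inner Q ` carrier Q)"

text \<open>The description determines a unique map by \<open>Inn_map_ex1\<close> below.\<close>

definition Inn_map ::
    "('a, 'm) quandle_scheme \<Rightarrow> ('b, 'n) quandle_scheme \<Rightarrow> ('a \<Rightarrow> 'b) \<Rightarrow> ('a \<Rightarrow> 'a) \<Rightarrow> 'b \<Rightarrow> 'b" where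
  "Inn_map P Q f = (THE h. h \<in> extensional (carrier (Inn P)) \<and> h \<in> epi (Inn P) (Inn Q) \<and>
     (\<forall>x\<in>carrier P. h (inner P x) = inner Q (f x)))"

definition Inn_rel ::
    "('a, 'm) quandle_scheme \<Rightarrow> ('b, 'n) quandle_scheme \<Rightarrow> ('a \<Rightarrow> 'b) \<Rightarrow> ('a \<Rightarrow> 'a) set" where
  "Inn_rel P Q f = kernel (Inn P) (Inn Q) (Inn_map P Q f)"

definition Trans_rel :: "('a, 'm) quandle_scheme \<Rightarrow> ('a \<Rightarrow> 'b) \<Rightarrow> ('a \<Rightarrow> 'a) set" where
  "Trans_rel P f = generate (Inn P)
     {inner P x \<otimes>\<^bsub>Inn P\<^esub> inv\<^bsub>Inn P\<^esub> inner P y | x y.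
        x \<in> carrier P \<and> y \<in> carrier P \<and> f x = f y}"


section \<open>Groups given by generators and relations\<close>

text \<open>The letters \<open>(x, True)\<close> and \<open>(x, False)\<close> of a word stand for the generator
  \<open>x\<close> and for its formal inverse.\<close>

type_synonym 'a word = "('a \<times> bool) list"

definition words :: "'a set \<Rightarrow> 'a word set" where
  "words X = lists (X \<times> UNIV)"

inductive_set pres_rel :: "'a set \<Rightarrow> ('a word \<times> 'a word) set \<Rightarrow> ('a word \<times> 'a word) set"
  for X :: "'a set" and R :: "('a word \<times> 'a word) set" where
  pres_refl: "w \<in> words X \<Longrightarrow> (w, w) \<in> pres_rel X R"
| pres_sym: "(v, w) \<in> pres_rel X R \<Longrightarrow> (w, v) \<in> pres_rel X R"
| pres_trans: "\<lbrakk>(u, v) \<in> pres_rel X R; (v, w) \<in> pres_rel X R\<rbrakk> \<Longrightarrow> (u, w) \<in> pres_rel X R"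
| pres_cancel: "\<lbrakk>u \<in> words X; v \<in> words X; x \<in> X\<rbrakk>
    \<Longrightarrow> (u @ [(x, b), (x, \<not> b)] @ v, u @ v) \<in> pres_rel X R"
| pres_relator: "\<lbrakk>u \<in> words X; v \<in> words X; (l, r) \<in> R; l \<in> words X; r \<in> words X\<rbrakk>
    \<Longrightarrow> (u @ l @ v, u @ r @ v) \<in> pres_rel X R"

definition presented_group :: "'a set \<Rightarrow> ('a word \<times> 'a word) set \<Rightarrow> 'a word set monoid" where
  "presented_group X R =
     \<lparr>carrier = words X // pres_rel X R,
      mult = (\<lambda>A B. \<Union>u\<in>A. \<Union>v\<in>B. pres_rel X R `` {u @ v}),
      one = pres_rel X R `` {[]}\<rparr>"

definition Adj_rels :: "('a, 'm) quandle_scheme \<Rightarrow> ('a word \<times> 'a word) set" where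
  "Adj_rels Q = {([(x, True), (y, True)], [(symm Q x y, True), (x, True)]) | x y.
     x \<in> carrier Q \<and> y \<in> carrier Q}"

definition Adj :: "('a, 'm) quandle_scheme \<Rightarrow> 'a word set monoid" where
  "Adj Q = presented_group (carrier Q) (Adj_rels Q)"

definition adj_gen :: "('a, 'm) quandle_scheme \<Rightarrow> 'a \<Rightarrow> 'a word set" where
  "adj_gen Q x = pres_rel (carrier Q) (Adj_rels Q) `` {[(x, True)]}"

text \<open>The description determines a unique map by \<open>Adj_map_ex1\<close> below.\<close>

definition Adj_map ::
    "('a, 'm) quandle_scheme \<Rightarrow> ('b, 'n) quandle_scheme \<Rightarrow> ('a \<Rightarrow> 'b) \<Rightarrow> 'a word set \<Rightarrow> 'b word set"
  where
  "Adj_map P Q f = (THE h. h \<in> extensional (carrier (Adj P)) \<and> h \<in> hom (Adj P) (Adj Q) \<and>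
     (\<forall>x\<in>carrier P. h (adj_gen P x) = adj_gen Q (f x)))"

definition Adj_rel ::
    "('a, 'm) quandle_scheme \<Rightarrow> ('b, 'n) quandle_scheme \<Rightarrow> ('a \<Rightarrow> 'b) \<Rightarrow> 'a word set set" where
  "Adj_rel P Q f = kernel (Adj P) (Adj Q) (Adj_map P Q f)"


section \<open>Transfinite lower central series\<close>

definition commutator_subgroup ::
    "('a, 'm) monoid_scheme \<Rightarrow> 'a set \<Rightarrow> 'a set \<Rightarrow> 'a set" where
  "commutator_subgroup G A B = generate G
     {a \<otimes>\<^bsub>G\<^esub> b \<otimes>\<^bsub>G\<^esub> inv\<^bsub>G\<^esub> a \<otimes>\<^bsub>G\<^esub> inv\<^bsub>G\<^esub> b | a b. a \<in> A \<and> b \<in> B}"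

definition is_pred :: "'o rel \<Rightarrow> 'o \<Rightarrow> 'o \<Rightarrow> bool" where
  "is_pred r \<beta> \<alpha> \<longleftrightarrow> \<beta> \<in> underS r \<alpha> \<and> (\<forall>\<gamma>\<in>underS r \<alpha>. (\<gamma>, \<beta>) \<in> r)"

text \<open>Ordinals are represented by the elements of the field of a well-order \<open>r\<close>: the element
  \<open>\<alpha>\<close> stands for the order type of \<^term>\<open>underS r \<alpha>\<close>. See \<open>Gamma_zero\<close>, \<open>Gamma_succ\<close> and
  \<open>Gamma_limit\<close> below for the resulting recursion equations.\<close>

definition Gamma :: "('a, 'm) monoid_scheme \<Rightarrow> 'a set \<Rightarrow> 'o rel \<Rightarrow> 'o \<Rightarrow> 'a set" where
  "Gamma G N r = wo_rel.worec r (\<lambda>\<Gamma> \<alpha>.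
     if underS r \<alpha> = {} then N
     else if \<exists>\<beta>. is_pred r \<beta> \<alpha>
       then commutator_subgroup G (carrier G) (\<Gamma> (THE \<beta>. is_pred r \<beta> \<alpha>))
     else (\<Inter>\<beta>\<in>underS r \<alpha>. \<Gamma> \<beta>))"

text \<open>HOL has no type of all ordinals, so the ordinals are taken from well-orders on the type
  of sets of group elements. By \<open>hypocentral_if_Gamma_trivial\<close> below this is no
  restriction: well-orders on arbitrary other types yield the same notion.\<close>

definition hypocentral :: "('a, 'm) monoid_scheme \<Rightarrow> 'a set \<Rightarrow> bool" where
  "hypocentral G N \<longleftrightarrow>
     (\<exists>r :: 'a set rel. Well_order r \<and> (\<exists>\<alpha>\<in>Field r. Gamma G N r \<alpha> = {\<one>\<^bsub>G\<^esub>}))"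

definition perfect_normal :: "('a, 'm) monoid_scheme \<Rightarrow> 'a set \<Rightarrow> bool" where
  "perfect_normal G K \<longleftrightarrow> K \<lhd> G \<and> commutator_subgroup G (carrier G) K = K"


section \<open>Well-definedness of the series\<close>

lemma underS_wo:
  assumes "Well_order r" "\<beta> \<in> underS r \<alpha>" "\<gamma> \<in> underS r \<beta>"
  shows "\<gamma> \<in> underS r \<alpha>"
proof -
  interpret wo_rel r using assms(1) by (simp add: wo_rel_def)
  have "(\<gamma>, \<alpha>) \<in> r" using assms(2,3) transD[OF TRANS, of \<gamma> \<beta> \<alpha>] by (simp add: underS_def)
  moreover have "\<gamma> \<noteq> \<alpha>" using assms(2,3) antisymD[OF ANTISYM, of \<beta> \<alpha>] by (auto simp: underS_def)
  ultimately show ?thesis by (simp add: underS_def)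
qed

lemma is_pred_unique: "Well_order r \<Longrightarrow> is_pred r \<beta> \<alpha> \<Longrightarrow> is_pred r \<gamma> \<alpha> \<Longrightarrow> \<beta> = \<gamma>"
  unfolding is_pred_def well_order_on_def linear_order_on_def partial_order_on_def antisym_def
  by blast

lemma Gamma_unfold:
  fixes G :: "('a, 'm) monoid_scheme" and r :: "'o rel"
  assumes r: "Well_order r"
  shows "Gamma G N r \<alpha> =
    (if underS r \<alpha> = {} then N
     else if \<exists>\<beta>. is_pred r \<beta> \<alpha>
       then commutator_subgroup G (carrier G) (Gamma G N r (THE \<beta>. is_pred r \<beta> \<alpha>))
     else (\<Inter>\<beta>\<in>underS r \<alpha>. Gamma G N r \<beta>))"
proof -
  interpret wo_rel r using r by (simp add: wo_rel_def)
  let ?H = "\<lambda>\<Gamma> \<alpha>. if underS \<alpha> = {} then N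
     else if \<exists>\<beta>. is_pred r \<beta> \<alpha>
       then commutator_subgroup G (carrier G) (\<Gamma> (THE \<beta>. is_pred r \<beta> \<alpha>))
     else (\<Inter>\<beta>\<in>underS \<alpha>. \<Gamma> \<beta>)"
  have "adm_wo ?H"
    unfolding adm_wo_def
  proof (intro allI impI)
    fix f g :: "'o \<Rightarrow> 'a set" and x
    assume eq: "\<forall>y\<in>underS x. f y = g y"
    have "f (THE \<beta>. is_pred r \<beta> x) = g (THE \<beta>. is_pred r \<beta> x)" if "is_pred r \<beta> x" for \<beta>
    proof -
      have "(THE \<beta>. is_pred r \<beta> x) = \<beta>"
        using is_pred_unique[OF r] that by blast
      then show ?thesis using eq that by (simp add: is_pred_def)
    qed
    then show "?H f x = ?H g x" using eq by auto
  qed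
  from worec_fixpoint[OF this] show ?thesis
    unfolding Gamma_def by (rule fun_cong)
qed

lemma Gamma_zero:
  assumes "Well_order r" "underS r \<alpha> = {}"
  shows "Gamma G N r \<alpha> = N"
  using Gamma_unfold[OF assms(1), of G N \<alpha>] assms(2) by (simp only: if_True simp_thms)

lemma Gamma_succ:
  assumes "Well_order r" "is_pred r \<beta> \<alpha>"
  shows "Gamma G N r \<alpha> = commutator_subgroup G (carrier G) (Gamma G N r \<beta>)"
proof -
  have 1: "(THE \<beta>. is_pred r \<beta> \<alpha>) = \<beta>"
    using is_pred_unique assms by (metis the_equality)
  have 2: "(underS r \<alpha> = {}) = False" using assms(2) by (auto simp: is_pred_def)
  have 3: "(\<exists>\<beta>. is_pred r \<beta> \<alpha>) = True" using assms(2) by auto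
  show ?thesis
    using Gamma_unfold[OF assms(1), of G N \<alpha>] by (simp only: 1 2 3 if_True if_False)
qed

lemma Gamma_limit:
  assumes "Well_order r" "underS r \<alpha> \<noteq> {}" "\<nexists>\<beta>. is_pred r \<beta> \<alpha>"
  shows "Gamma G N r \<alpha> = (\<Inter>\<beta>\<in>underS r \<alpha>. Gamma G N r \<beta>)"
  using Gamma_unfold[OF assms(1), of G N \<alpha>] assms(2,3) by (simp only: if_False simp_thms)


context group begin

lemma commutator_subgroup_subset_normal:
  assumes "N \<lhd> G"
  shows "commutator_subgroup G (carrier G) N \<subseteq> N"
proof -
  interpret N: normal N G by fact
  have "a \<otimes> b \<otimes> inv a \<otimes> inv b \<in> N" if "a \<in> carrier G" "b \<in> N" for a b
    using N.inv_op_closed2[OF that] that by blast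
  then show ?thesis
    unfolding commutator_subgroup_def
    by (intro generate_subgroup_incl) (auto intro: N.subgroup_axioms)
qed

lemma commutator_subgroup_normal:
  assumes "N \<lhd> G"
  shows "commutator_subgroup G (carrier G) N \<lhd> G"
proof -
  interpret N: normal N G by fact
  show ?thesis
    unfolding commutator_subgroup_def
  proof (rule normal_generateI)
    show "{a \<otimes> b \<otimes> inv a \<otimes> inv b |a b. a \<in> carrier G \<and> b \<in> N} \<subseteq> carrier G"
      using N.subset by auto
  next
    fix h g
    assume "h \<in> {a \<otimes> b \<otimes> inv a \<otimes> inv b |a b. a \<in> carrier G \<and> b \<in> N}" and g: "g \<in> carrier G"
    then obtain a b where ab: "a \<in> carrier G" "b \<in> N" "h = a \<otimes> b \<otimes> inv a \<otimes> inv b" by auto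
    then have b: "b \<in> carrier G" using N.subset by auto
    have c: "inv g \<otimes> (g \<otimes> z) = z" if "z \<in> carrier G" for z
      using that g by (simp add: m_assoc[symmetric])
    have "g \<otimes> b \<otimes> inv g \<in> N" using N.inv_op_closed2 g ab(2) by blast
    moreover have "g \<otimes> a \<otimes> inv g \<in> carrier G" using g ab by auto
    moreover have "g \<otimes> h \<otimes> inv g = (g \<otimes> a \<otimes> inv g) \<otimes> (g \<otimes> b \<otimes> inv g) \<otimes>
        inv (g \<otimes> a \<otimes> inv g) \<otimes> inv (g \<otimes> b \<otimes> inv g)"
      using g ab(1,3) b c by (simp add: inv_mult_group m_assoc)
    ultimately show "g \<otimes> h \<otimes> inv g \<in> {a \<otimes> b \<otimes> inv a \<otimes> inv b |a b. a \<in> carrier G \<and> b \<in> N}"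
      by blast
  qed
qed

lemma normal_Inter:
  assumes "I \<noteq> {}" "\<And>i. i \<in> I \<Longrightarrow> H i \<lhd> G"
  shows "(\<Inter>i\<in>I. H i) \<lhd> G"
proof -
  have "subgroup (\<Inter>(H ` I)) G"
    by (rule subgroups_Inter) (use assms in \<open>blast dest: normal_imp_subgroup\<close>)+
  moreover have "x \<otimes> h \<otimes> inv x \<in> (\<Inter>i\<in>I. H i)"
    if "x \<in> carrier G" "h \<in> (\<Inter>i\<in>I. H i)" for x h
    using normal.inv_op_closed2[OF assms(2)] that by blast
  ultimately show ?thesis by (intro normal_invI)
qed

lemma Gamma_normal:
  assumes r: "Well_order r" and N: "N \<lhd> G"
  shows "Gamma G N r \<alpha> \<lhd> G"
proof -
  interpret wo_rel r using r by (simp add: wo_rel_def)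
  show ?thesis
  proof (induction \<alpha> rule: well_order_induct)
    case (1 \<alpha>)
    then have IH: "Gamma G N r \<beta> \<lhd> G" if "\<beta> \<in> underS \<alpha>" for \<beta>
      using that by (auto simp: underS_def)
    consider "underS \<alpha> = {}" | \<beta> where "is_pred r \<beta> \<alpha>" 
      | "underS \<alpha> \<noteq> {}" "\<nexists>\<beta>. is_pred r \<beta> \<alpha>" by blast
    then show ?case
    proof cases
      case 1 then show ?thesis using Gamma_zero[OF r 1, of G N] N by (simp only:)
    next
      case 2
      then have "\<beta> \<in> underS \<alpha>" by (simp add: is_pred_def)
      then show ?thesis
        using Gamma_succ[OF r 2, of G N] commutator_subgroup_normal[OF IH] by (simp only:)
    next
      case 3
      show ?thesis unfolding Gamma_limit[OF r 3] by (rule normal_Inter[OF 3(1) IH])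
    qed
  qed
qed

lemma Gamma_antimono:
  assumes r: "Well_order r" and N: "N \<lhd> G" and "(\<beta>, \<alpha>) \<in> r"
  shows "Gamma G N r \<alpha> \<subseteq> Gamma G N r \<beta>"
proof -
  interpret wo_rel r using r by (simp add: wo_rel_def)
  show ?thesis using \<open>(\<beta>, \<alpha>) \<in> r\<close>
  proof (induction \<alpha> rule: well_order_induct)
    case (1 \<alpha>)
    show ?case
    proof (cases "\<beta> = \<alpha>")
      case False
      then have \<beta>: "\<beta> \<in> underS \<alpha>" using 1 by (simp add: underS_def)
      show ?thesis
      proof (cases "\<exists>\<gamma>. is_pred r \<gamma> \<alpha>")
        case True
        then obtain \<gamma> where \<gamma>: "is_pred r \<gamma> \<alpha>" by auto
        then have "Gamma G N r \<gamma> \<subseteq> Gamma G N r \<beta>"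
          using 1 \<beta> by (auto simp: is_pred_def underS_def)
        then show ?thesis
          using Gamma_succ[OF r \<gamma>, of G N]
            commutator_subgroup_subset_normal[OF Gamma_normal[OF r N], of \<gamma>] by blast
      next
        case False
        have "Gamma G N r \<alpha> = (\<Inter>\<delta>\<in>underS \<alpha>. Gamma G N r \<delta>)"
          by (rule Gamma_limit[OF r _ False]) (use \<beta> in blast)
        then show ?thesis using \<beta> by blast
      qed
    qed simp
  qed
qed

lemma Gamma_stationary:
  assumes r: "Well_order r" and N: "N \<lhd> G" and "(\<beta>, \<gamma>) \<in> r" "\<beta> \<noteq> \<gamma>"
    and eq: "Gamma G N r \<beta> = Gamma G N r \<gamma>" and "(\<beta>, \<alpha>) \<in> r"
  shows "Gamma G N r \<alpha> = Gamma G N r \<beta>"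
proof -
  interpret wo_rel r using r by (simp add: wo_rel_def)
  have perf: "commutator_subgroup G (carrier G) (Gamma G N r \<beta>) = Gamma G N r \<beta>"
  proof -
    define \<sigma> where "\<sigma> = suc {\<beta>}"
    have F: "{\<beta>} \<subseteq> Field r" using \<open>(\<beta>, \<gamma>) \<in> r\<close> by (auto simp: Field_def)
    have A: "AboveS {\<beta>} \<noteq> {}" using \<open>(\<beta>, \<gamma>) \<in> r\<close> \<open>\<beta> \<noteq> \<gamma>\<close>
      by (auto simp: AboveS_def Field_def)
    have 1: "\<beta> \<in> underS \<sigma>"
      using suc_greater[OF F A, of \<beta>] by (auto simp: underS_def \<sigma>_def)
    have 2: "(\<sigma>, \<gamma>) \<in> r" 
      using suc_least_AboveS[of \<gamma> "{\<beta>}"] \<open>(\<beta>, \<gamma>) \<in> r\<close> \<open>\<beta> \<noteq> \<gamma>\<close> 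
      by (auto simp: AboveS_def Field_def \<sigma>_def)
    have 3: "(\<delta>, \<beta>) \<in> r" if "\<delta> \<in> underS \<sigma>" for \<delta>
    proof (rule ccontr)
      assume "(\<delta>, \<beta>) \<notin> r"
      moreover have "\<delta> \<in> Field r" using that by (auto simp: underS_def Field_def)
      ultimately have "\<delta> \<in> AboveS {\<beta>}" using F TOTALS REFL
        by (auto simp: AboveS_def refl_on_def)
      then have "(\<sigma>, \<delta>) \<in> r" unfolding \<sigma>_def by (rule suc_least_AboveS)
      then show False using that antisymD[OF ANTISYM, of \<sigma> \<delta>] by (auto simp: underS_def)
    qed
    have "is_pred r \<beta> \<sigma>" using 1 3 by (simp add: is_pred_def)
    then have *: "Gamma G N r \<sigma> = commutator_subgroup G (carrier G) (Gamma G N r \<beta>)"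
      by (rule Gamma_succ[OF r])
    have "Gamma G N r \<gamma> \<subseteq> Gamma G N r \<sigma>" using Gamma_antimono[OF r N 2] .
    then show ?thesis
      using * eq commutator_subgroup_subset_normal[OF Gamma_normal[OF r N], of \<beta>] by auto
  qed
  show ?thesis using \<open>(\<beta>, \<alpha>) \<in> r\<close>
  proof (induction \<alpha> rule: well_order_induct)
    case (1 \<alpha>)
    have IH: "Gamma G N r \<delta> = Gamma G N r \<beta>" if "\<delta> \<in> underS \<alpha>" "(\<beta>, \<delta>) \<in> r" for \<delta>
      using 1(1) that unfolding underS_def by blast
    show ?case
    proof (cases "\<beta> = \<alpha>")
      case False
      then have \<beta>: "\<beta> \<in> underS \<alpha>" using 1 by (simp add: underS_def)
      show ?thesis
      proof (cases "\<exists>\<delta>. is_pred r \<delta> \<alpha>")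
        case True
        then obtain \<delta> where \<delta>: "is_pred r \<delta> \<alpha>" by auto
        then have "Gamma G N r \<delta> = Gamma G N r \<beta>"
          using IH \<beta> unfolding is_pred_def by blast
        then show ?thesis using Gamma_succ[OF r \<delta>, of G N] perf by (simp only:)
      next
        case False
        have "Gamma G N r \<beta> \<subseteq> Gamma G N r \<delta>" if "\<delta> \<in> underS \<alpha>" for \<delta>
        proof (cases "(\<beta>, \<delta>) \<in> r")
          case True
          then show ?thesis using IH that by blast
        next
          case False
          then have "(\<delta>, \<beta>) \<in> r" using that \<beta> TOTALS by (auto simp: underS_def Field_def)
          then show ?thesis by (rule Gamma_antimono[OF r N])
        qed
        moreover have "Gamma G N r \<alpha> = (\<Inter>\<delta>\<in>underS \<alpha>. Gamma G N r \<delta>)"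
          by (rule Gamma_limit[OF r _ False]) (use \<beta> in blast)
        ultimately have "Gamma G N r \<beta> \<subseteq> Gamma G N r \<alpha>" by blast
        then show ?thesis using Gamma_antimono[OF r N] 1(2) by blast
      qed
    qed simp
  qed
qed

theorem hypocentral_if_Gamma_trivial:
  fixes r :: "'o rel"
  assumes r: "Well_order r" and N: "N \<lhd> G" and "\<alpha> \<in> Field r" and "Gamma G N r \<alpha> = {\<one>}"
  shows "hypocentral G N"
proof -
  interpret wo_rel r using r by (simp add: wo_rel_def)
  let ?g = "Gamma G N r"
  obtain \<mu> where \<mu>: "\<mu> \<in> Field r" "?g \<mu> = {\<one>}" 
    and least: "\<And>\<beta>. \<beta> \<in> underS \<mu> \<Longrightarrow> ?g \<beta> \<noteq> {\<one>}"
  proof -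
    let ?M = "{\<beta> \<in> Field r. ?g \<beta> = {\<one>}}"
    have "\<alpha> \<in> ?M" using assms by auto
    from wfE_min[OF WF this] obtain \<mu> where \<mu>: "\<mu> \<in> ?M"
      and min: "\<And>\<beta>. (\<beta>, \<mu>) \<in> r - Id \<Longrightarrow> \<beta> \<notin> ?M"
      by blast
    have "?g \<beta> \<noteq> {\<one>}" if "\<beta> \<in> underS \<mu>" for \<beta>
    proof -
      have "(\<beta>, \<mu>) \<in> r - Id" "\<beta> \<in> Field r" using that by (auto simp: underS_def Field_def)
      then show ?thesis using min by blast
    qed
    then show ?thesis using \<mu> that by blast
  qed
  define A where "A = under \<mu>"
  have down: "\<gamma> \<in> A" if "\<beta> \<in> A" "(\<gamma>, \<beta>) \<in> r" for \<beta> \<gamma>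
    using that transD[OF TRANS] by (auto simp: A_def under_def)
  have AF: "A \<subseteq> Field r" by (auto simp: A_def under_def Field_def)
  have \<mu>A: "\<mu> \<in> A" using \<mu> REFL by (auto simp: A_def under_def refl_on_def)
  have inj: "?g \<beta> \<noteq> ?g \<gamma>" if "\<beta> \<in> A" "\<gamma> \<in> A" "(\<beta>, \<gamma>) \<in> r" "\<beta> \<noteq> \<gamma>" for \<beta> \<gamma>
  proof
    assume "?g \<beta> = ?g \<gamma>"
    have "(\<beta>, \<mu>) \<in> r" "(\<gamma>, \<mu>) \<in> r" using that by (auto simp: A_def under_def)
    moreover have "\<beta> \<noteq> \<mu>" using calculation that antisymD[OF ANTISYM, of \<beta> \<gamma>] by auto
    ultimately have "?g \<mu> = ?g \<beta>" "\<beta> \<in> underS \<mu>"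
      using Gamma_stationary[OF r N that(3,4) \<open>?g \<beta> = ?g \<gamma>\<close>] by (auto simp: underS_def)
    then show False using least \<mu> by auto
  qed
  have inj: "inj_on ?g A"
  proof (rule inj_onI, rule ccontr)
    fix \<beta> \<gamma> assume *: "\<beta> \<in> A" "\<gamma> \<in> A" "?g \<beta> = ?g \<gamma>" "\<beta> \<noteq> \<gamma>"
    then have "(\<beta>, \<gamma>) \<in> r \<or> (\<gamma>, \<beta>) \<in> r" using TOTALS AF by blast
    then show False using inj[of \<beta> \<gamma>] inj[of \<gamma> \<beta>] * by auto
  qed
  let ?s = "Restr r A"
  have "Well_order ?s" using Well_order_Restr r by blast
  have Fs: "Field ?s = A" using AF REFL by (auto simp: Field_def refl_on_def)
  define r' where "r' = dir_image ?s ?g"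
  have r': "Well_order r'" unfolding r'_def
    using Well_order_dir_image[OF \<open>Well_order ?s\<close>] Fs inj by simp
  have r'_iff: "(?g \<gamma>, ?g \<beta>) \<in> r' \<longleftrightarrow> (\<gamma>, \<beta>) \<in> r" if "\<beta> \<in> A" "\<gamma> \<in> A" for \<beta> \<gamma>
  proof
    assume "(?g \<gamma>, ?g \<beta>) \<in> r'"
    then obtain a b where "?g \<gamma> = ?g a" "?g \<beta> = ?g b" "(a, b) \<in> r" "a \<in> A" "b \<in> A"
      unfolding r'_def dir_image_def by blast
    then show "(\<gamma>, \<beta>) \<in> r" using inj_onD[OF inj] that by metis
  next
    assume "(\<gamma>, \<beta>) \<in> r"
    then show "(?g \<gamma>, ?g \<beta>) \<in> r'" using that unfolding r'_def dir_image_def by blast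
  qed
  have uS: "Order_Relation.underS r' (?g \<beta>) = ?g ` Order_Relation.underS r \<beta>" if "\<beta> \<in> A" for \<beta>
  proof (intro equalityI subsetI)
    fix y assume y: "y \<in> Order_Relation.underS r' (?g \<beta>)"
    then obtain \<gamma> where \<gamma>: "\<gamma> \<in> A" "y = ?g \<gamma>"
      using Fs by (auto simp: Order_Relation.underS_def r'_def dir_image_def)
    with y have "(?g \<gamma>, ?g \<beta>) \<in> r'" "\<gamma> \<noteq> \<beta>" by (auto simp: Order_Relation.underS_def)
    then show "y \<in> ?g ` Order_Relation.underS r \<beta>"
      using r'_iff[OF that \<gamma>(1)] \<gamma>(2) by (auto simp: Order_Relation.underS_def)
  next
    fix y assume "y \<in> ?g ` Order_Relation.underS r \<beta>"
    then obtain \<gamma> where \<gamma>: "(\<gamma>, \<beta>) \<in> r" "\<gamma> \<noteq> \<beta>" "y = ?g \<gamma>"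
      by (auto simp: Order_Relation.underS_def)
    then have "\<gamma> \<in> A" using down that by blast
    then show "y \<in> Order_Relation.underS r' (?g \<beta>)"
      using r'_iff[OF that, of \<gamma>] \<gamma> inj_onD[OF inj, of \<gamma> \<beta>] that
      by (auto simp: Order_Relation.underS_def)
  qed
  have main: "\<beta> \<in> A \<Longrightarrow> Gamma G N r' (?g \<beta>) = ?g \<beta>" for \<beta>
  proof (induction \<beta> rule: well_order_induct)
    case (1 \<beta>)
    have uA: "underS \<beta> \<subseteq> A" using down 1 by (auto simp: underS_def)
    have IH: "Gamma G N r' (?g \<gamma>) = ?g \<gamma>" if "\<gamma> \<in> underS \<beta>" for \<gamma>
      using that uA 1 by (auto simp: underS_def)
    have pred: "is_pred r' (?g \<gamma>) (?g \<beta>) \<longleftrightarrow> is_pred r \<gamma> \<beta>" if "\<gamma> \<in> A" for \<gamma>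
    proof -
      have "?g \<gamma> \<in> ?g ` underS \<beta> \<longleftrightarrow> \<gamma> \<in> underS \<beta>"
        using inj that uA by (meson inj_on_image_mem_iff)
      then show ?thesis
        unfolding is_pred_def uS[OF \<open>\<beta> \<in> A\<close>] using r'_iff uA that by (auto simp: subset_iff)
    qed
    consider "underS \<beta> = {}" | \<gamma> where "is_pred r \<gamma> \<beta>" 
      | "underS \<beta> \<noteq> {}" "\<nexists>\<gamma>. is_pred r \<gamma> \<beta>" by blast
    then show ?case
    proof cases
      case 1
      then have "Order_Relation.underS r' (?g \<beta>) = {}" using uS \<open>\<beta> \<in> A\<close> by simp
      from Gamma_zero[OF r' this, of G N] Gamma_zero[OF r 1, of G N] show ?thesis by (simp only:)
    next
      case 2
      then have "\<gamma> \<in> underS \<beta>" by (simp add: is_pred_def)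
      then have "is_pred r' (?g \<gamma>) (?g \<beta>)" using pred 2 uA by blast
      from Gamma_succ[OF r' this, of G N] Gamma_succ[OF r 2, of G N] IH[OF \<open>\<gamma> \<in> underS \<beta>\<close>]
      show ?thesis by (simp only:)
    next
      case 3
      have "Order_Relation.underS r' (?g \<beta>) \<noteq> {}" using uS \<open>\<beta> \<in> A\<close> 3 by simp
      moreover have "\<nexists>\<gamma>. is_pred r' \<gamma> (?g \<beta>)"
      proof
        assume "\<exists>\<gamma>. is_pred r' \<gamma> (?g \<beta>)"
        then obtain \<gamma> where \<gamma>: "is_pred r' \<gamma> (?g \<beta>)" by auto
        then have "\<gamma> \<in> ?g ` underS \<beta>" using uS \<open>\<beta> \<in> A\<close> by (simp add: is_pred_def)
        then show False using \<gamma> pred uA 3 by blast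
      qed
      ultimately have "Gamma G N r' (?g \<beta>) = (\<Inter>\<gamma>\<in>?g ` underS \<beta>. Gamma G N r' \<gamma>)"
        using Gamma_limit[OF r', of "?g \<beta>" G N] uS[OF \<open>\<beta> \<in> A\<close>] by simp
      also have "\<dots> = (\<Inter>\<gamma>\<in>underS \<beta>. ?g \<gamma>)" using IH by auto
      also have "\<dots> = ?g \<beta>" by (rule Gamma_limit[OF r 3, symmetric])
      finally show ?thesis .
    qed
  qed
  have "?g \<mu> \<in> Field r'"
    using \<mu>A Fs by (simp add: r'_def dir_image_Field)
  moreover have "Gamma G N r' (?g \<mu>) = {\<one>}" using main[OF \<mu>A] \<mu> by simp
  ultimately show ?thesis using r' unfolding hypocentral_def by blast
qed

end


section \<open>Well-definedness of the induced homomorphisms\<close>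

lemma hom_eq_on_generate:
  assumes G: "group G" and H: "group H" and S: "S \<subseteq> carrier G"
    and h: "h \<in> hom (subgroup_generated G S) H" and k: "k \<in> hom (subgroup_generated G S) H"
    and eq: "\<And>s. s \<in> S \<Longrightarrow> h s = k s"
    and x: "x \<in> carrier (subgroup_generated G S)"
  shows "h x = k x"
proof -
  let ?S = "subgroup_generated G S"
  interpret G: group G by fact
  interpret h: group_hom ?S H h
    using h H by (simp add: group_hom_def group_hom_axioms_def)
  interpret k: group_hom ?S H k
    using k H by (simp add: group_hom_def group_hom_axioms_def)
  have C: "carrier ?S = generate G S"
    using S by (simp add: carrier_subgroup_generated Int_absorb1)
  have "x \<in> generate G S" using x C by simp
  then show ?thesis
  proof induction
    case one
    show ?case using h.hom_one k.hom_one by simp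
  next
    case (incl s) then show ?case by (rule eq)
  next
    case (inv s)
    then have s: "s \<in> carrier ?S" using C generate.incl by simp
    then have "inv\<^bsub>?S\<^esub> s = inv\<^bsub>G\<^esub> s" by simp
    then show ?case using h.hom_inv[OF s] k.hom_inv[OF s] eq[OF inv] by simp
  next
    case (eng a b)
    then show ?case using h.hom_mult[of a b] k.hom_mult[of a b] C by simp
  qed
qed

lemma BijGroup_simps [simp]:
  "carrier (BijGroup S) = Bij S" "\<one>\<^bsub>BijGroup S\<^esub> = (\<lambda>x\<in>S. x)"
  "\<lbrakk>g \<in> Bij S; h \<in> Bij S\<rbrakk> \<Longrightarrow> g \<otimes>\<^bsub>BijGroup S\<^esub> h = compose S g h"
  by (simp_all add: BijGroup_def)

lemma Aut_simps [simp]: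
  "carrier (Aut Q) = quandle_auto Q" "\<one>\<^bsub>Aut Q\<^esub> = (\<lambda>x\<in>carrier Q. x)"
  "\<lbrakk>g \<in> quandle_auto Q; h \<in> quandle_auto Q\<rbrakk> \<Longrightarrow> g \<otimes>\<^bsub>Aut Q\<^esub> h = compose (carrier Q) g h"
  by (auto simp: Aut_def quandle_auto_def)

lemma Bij_mem: "g \<in> Bij S \<Longrightarrow> x \<in> S \<Longrightarrow> g x \<in> S"
  using Bij_imp_funcset by blast

context quandle begin

lemma symm_closed: "x \<in> carrier Q \<Longrightarrow> y \<in> carrier Q \<Longrightarrow> symm Q x y \<in> carrier Q"
  using symm_bij bij_betwE by blast

lemma subgroup_quandle_auto: "subgroup (quandle_auto Q) (BijGroup (carrier Q))"
proof -
  interpret B: group "BijGroup (carrier Q)" by (rule group_BijGroup)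
  show ?thesis
  proof (rule subgroup.intro)
    show "quandle_auto Q \<subseteq> carrier (BijGroup (carrier Q))"
      by (auto simp: quandle_auto_def)
  next
    fix g h assume gh: "g \<in> quandle_auto Q" "h \<in> quandle_auto Q"
    then have "compose (carrier Q) g h \<in> Bij (carrier Q)"
      by (auto simp: quandle_auto_def intro: compose_Bij)
    then show "g \<otimes>\<^bsub>BijGroup (carrier Q)\<^esub> h \<in> quandle_auto Q"
      using gh symm_closed by (auto simp: quandle_auto_def quandle_hom_def compose_eq Pi_iff)
  next
    show "\<one>\<^bsub>BijGroup (carrier Q)\<^esub> \<in> quandle_auto Q"
      using symm_closed by (auto simp: quandle_auto_def quandle_hom_def id_Bij)
  next
    fix g assume g: "g \<in> quandle_auto Q"
    then have gB: "g \<in> Bij (carrier Q)" by (simp add: quandle_auto_def)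
    let ?k = "restrict (inv_into (carrier Q) g) (carrier Q)"
    have "?k (symm Q x y) = symm Q (?k x) (?k y)" if "x \<in> carrier Q" "y \<in> carrier Q" for x y
    proof -
      have "inv_into (carrier Q) g (symm Q x y)
          = symm Q (inv_into (carrier Q) g x) (inv_into (carrier Q) g y)"
        by (rule Bij_inv_into_lemma)
          (use g gB that symm_closed in \<open>auto simp: quandle_auto_def quandle_hom_def\<close>)
      then show ?thesis using that symm_closed by simp
    qed
    moreover have "?k \<in> Bij (carrier Q)" using gB by (rule restrict_inv_into_Bij)
    ultimately show "inv\<^bsub>BijGroup (carrier Q)\<^esub> g \<in> quandle_auto Q"
      using gB Bij_imp_funcset[of ?k "carrier Q"]
      by (simp add: inv_BijGroup quandle_auto_def quandle_hom_def del: restrict_apply)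
  qed
qed

lemma group_Aut: "group (Aut Q)"
  unfolding Aut_def
  by (rule subgroup.subgroup_is_group[OF subgroup_quandle_auto group_BijGroup])

lemma inner_in_Aut:
  assumes x: "x \<in> carrier Q"
  shows "inner Q x \<in> carrier (Aut Q)"
proof -
  have "bij_betw (inner Q x) (carrier Q) (carrier Q)"
    using symm_bij[OF x] bij_betw_cong[of "carrier Q" "inner Q x" "symm Q x" "carrier Q"]
    by (simp add: inner_def)
  then have "inner Q x \<in> Bij (carrier Q)" by (simp add: Bij_def inner_def)
  moreover have "inner Q x (symm Q y z) = symm Q (inner Q x y) (inner Q x z)"
    if "y \<in> carrier Q" "z \<in> carrier Q" for y z
    using symm_symm[OF x that] that symm_closed by (simp add: inner_def)
  ultimately show ?thesis
    using Bij_imp_funcset by (simp add: quandle_auto_def quandle_hom_def)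
qed

lemma group_Inn: "group (Inn Q)"
  unfolding Inn_def by (rule group.group_subgroup_generated[OF group_Aut])

lemma carrier_Inn: "carrier (Inn Q) = generate (Aut Q) (inner Q ` carrier Q)"
  unfolding Inn_def carrier_subgroup_generated
  by (rule arg_cong[where f = "generate (Aut Q)"]) (use inner_in_Aut in blast)

lemma Inn_subset_Aut: "carrier (Inn Q) \<subseteq> quandle_auto Q"
  unfolding carrier_Inn Aut_simps(1)[symmetric]
  by (rule group.generate_incl[OF group_Aut]) (use inner_in_Aut in blast)

lemma inner_in_Inn: "x \<in> carrier Q \<Longrightarrow> inner Q x \<in> carrier (Inn Q)"
  unfolding carrier_Inn by (rule generate.incl) (rule imageI)

lemma Inn_mult: "\<lbrakk>g \<in> carrier (Inn Q); h \<in> carrier (Inn Q)\<rbrakk> \<Longrightarrow> g \<otimes>\<^bsub>Inn Q\<^esub> h = compose (carrier Q) g h"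
  using Aut_simps(3)[OF subsetD[OF Inn_subset_Aut] subsetD[OF Inn_subset_Aut]]
  by (simp only: Inn_def mult_subgroup_generated)

lemma Inn_Bij: "g \<in> carrier (Inn Q) \<Longrightarrow> g \<in> Bij (carrier Q)"
  using subsetD[OF Inn_subset_Aut] unfolding quandle_auto_def by blast

lemma inv_Inn: 
  assumes "g \<in> carrier (Inn Q)" "x \<in> carrier Q"
  shows "(inv\<^bsub>Inn Q\<^esub> g) (g x) = x" "g ((inv\<^bsub>Inn Q\<^esub> g) x) = x"
proof -
  interpret I: group "Inn Q" by (rule group_Inn)
  have one: "\<one>\<^bsub>Inn Q\<^esub> = (\<lambda>x\<in>carrier Q. x)" by (simp add: Inn_def)
  have i: "inv\<^bsub>Inn Q\<^esub> g \<in> carrier (Inn Q)" using assms by simp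
  have "compose (carrier Q) (inv\<^bsub>Inn Q\<^esub> g) g = (\<lambda>x\<in>carrier Q. x)"
    "compose (carrier Q) g (inv\<^bsub>Inn Q\<^esub> g) = (\<lambda>x\<in>carrier Q. x)"
    using I.l_inv[OF assms(1)] I.r_inv[OF assms(1)] Inn_mult i assms(1) one by simp_all
  then have "compose (carrier Q) (inv\<^bsub>Inn Q\<^esub> g) g x = x" "compose (carrier Q) g (inv\<^bsub>Inn Q\<^esub> g) x = x"
    using assms(2) by simp_all
  then show "(inv\<^bsub>Inn Q\<^esub> g) (g x) = x" "g ((inv\<^bsub>Inn Q\<^esub> g) x) = x"
    using assms(2) by (simp_all add: compose_eq)
qed

end

lemma Inn_gen_inv:
  assumes "quandle Q" "s \<in> carrier (Inn Q)"
  shows "inv\<^bsub>Aut Q\<^esub> s = inv\<^bsub>Inn Q\<^esub> s"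
  unfolding Inn_def
  by (rule group.inv_subgroup_generated[OF quandle.group_Aut[OF assms(1)], symmetric])
    (rule assms(2)[unfolded Inn_def])

context
  fixes P :: "('a, 'm) quandle_scheme" and Q :: "('b, 'n) quandle_scheme" and f :: "'a \<Rightarrow> 'b"
  assumes P: "quandle P" and Q: "quandle Q" and f: "f \<in> quandle_epi P Q"
begin

interpretation P: quandle P by (rule P)
interpretation Q: quandle Q by (rule Q)

lemma f_props:
  "x \<in> carrier P \<Longrightarrow> f x \<in> carrier Q"
  "\<lbrakk>x \<in> carrier P; y \<in> carrier P\<rbrakk> \<Longrightarrow> f (symm P x y) = symm Q (f x) (f y)"
  "f ` carrier P = carrier Q"
  using f by (auto simp: quandle_epi_def quandle_hom_def)

definition compat :: "('a \<Rightarrow> 'a) \<Rightarrow> ('b \<Rightarrow> 'b) \<Rightarrow> bool" where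
  "compat g h \<longleftrightarrow> (\<forall>x\<in>carrier P. f (g x) = h (f x))"

lemma inner_lift:
  assumes "s \<in> inner Q ` carrier Q"
  shows "\<exists>x. x \<in> carrier P \<and> s = inner Q (f x)"
proof -
  obtain y where y: "y \<in> carrier Q" "s = inner Q y" using assms by (rule imageE)
  have "y \<in> f ` carrier P" using y(1) unfolding f_props(3) .
  then obtain x where "x \<in> carrier P" "y = f x" by (metis imageE)
  then show ?thesis using y(2) by blast
qed

lemma compat_inner: "x \<in> carrier P \<Longrightarrow> compat (inner P x) (inner Q (f x))"
  by (auto simp: compat_def inner_def f_props)

lemma compat_inv:
  assumes "g \<in> carrier (Inn P)" "h \<in> carrier (Inn Q)" "compat g h"
  shows "compat (inv\<^bsub>Inn P\<^esub> g) (inv\<^bsub>Inn Q\<^esub> h)"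
  unfolding compat_def
proof
  fix x assume x: "x \<in> carrier P"
  let ?y = "(inv\<^bsub>Inn P\<^esub> g) x"
  have y: "?y \<in> carrier P"
    using Bij_mem[OF P.Inn_Bij] group.inv_closed[OF P.group_Inn assms(1)] x by blast
  have "f x = f (g ?y)" using P.inv_Inn(2)[OF assms(1) x] by simp
  also have "\<dots> = h (f ?y)" using assms(3) y by (simp add: compat_def)
  finally have "(inv\<^bsub>Inn Q\<^esub> h) (f x) = (inv\<^bsub>Inn Q\<^esub> h) (h (f ?y))" by simp
  then show "f ?y = (inv\<^bsub>Inn Q\<^esub> h) (f x)"
    unfolding Q.inv_Inn(1)[OF assms(2) f_props(1)[OF y]] by (simp only:)
qed

lemma compat_mult:
  assumes "g \<in> carrier (Inn P)" "h \<in> carrier (Inn Q)" "compat g h"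
    "g' \<in> carrier (Inn P)" "h' \<in> carrier (Inn Q)" "compat g' h'"
  shows "compat (g \<otimes>\<^bsub>Inn P\<^esub> g') (h \<otimes>\<^bsub>Inn Q\<^esub> h')"
  unfolding compat_def
proof
  fix x assume x: "x \<in> carrier P"
  then have "g' x \<in> carrier P" by (rule Bij_mem[OF P.Inn_Bij[OF assms(4)]])
  then have "f (g (g' x)) = h (h' (f x))"
    using assms(3,6) x unfolding compat_def by (simp only:)
  then show "f ((g \<otimes>\<^bsub>Inn P\<^esub> g') x) = (h \<otimes>\<^bsub>Inn Q\<^esub> h') (f x)"
    using x f_props(1)[OF x]
    by (simp only: P.Inn_mult[OF assms(1,4)] Q.Inn_mult[OF assms(2,5)] compose_eq)
qed

lemma compat_one: "compat \<one>\<^bsub>Inn P\<^esub> \<one>\<^bsub>Inn Q\<^esub>"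
  using f_props(1) by (simp add: compat_def Inn_def)

lemma compat_unique:
  assumes "h \<in> carrier (Inn Q)" "h' \<in> carrier (Inn Q)" "compat g h" "compat g h'"
  shows "h = h'"
proof (rule extensionalityI)
  show "h \<in> extensional (carrier Q)" "h' \<in> extensional (carrier Q)"
    by (rule Bij_imp_extensional[OF Q.Inn_Bij[OF assms(1)]] Bij_imp_extensional[OF Q.Inn_Bij[OF assms(2)]])+
  fix y assume "y \<in> carrier Q"
  then obtain x where x: "x \<in> carrier P" "y = f x" using f_props(3) by blast
  have "f (g x) = h (f x)" "f (g x) = h' (f x)"
    using assms(3,4) x(1) unfolding compat_def by blast+
  then show "h y = h' y" using x by metis
qed

lemma compat_ex1: "g \<in> carrier (Inn P) \<Longrightarrow> \<exists>h\<in>carrier (Inn Q). compat g h"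
  unfolding P.carrier_Inn
proof (induction rule: generate.induct)
  case one
  have "\<one>\<^bsub>Aut P\<^esub> = \<one>\<^bsub>Inn P\<^esub>" by (simp only: Inn_def one_subgroup_generated)
  then have "compat \<one>\<^bsub>Aut P\<^esub> \<one>\<^bsub>Inn Q\<^esub>" using compat_one by (simp only:)
  then show ?case
    using monoid.one_closed[OF group.is_monoid[OF Q.group_Inn]] by blast
next
  case (incl s)
  then show ?case using compat_inner Q.inner_in_Inn f_props(1) by blast
next
  case (inv s)
  then obtain x where x: "x \<in> carrier P" "s = inner P x" by blast
  have "compat (inv\<^bsub>Inn P\<^esub> s) (inv\<^bsub>Inn Q\<^esub> inner Q (f x))"
    using x compat_inv[OF P.inner_in_Inn Q.inner_in_Inn compat_inner] f_props(1) by blast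
  moreover have "inv\<^bsub>Inn Q\<^esub> inner Q (f x) \<in> carrier (Inn Q)"
    using x group.inv_closed[OF Q.group_Inn Q.inner_in_Inn] f_props(1) by blast
  moreover have e: "inv\<^bsub>Aut P\<^esub> s = inv\<^bsub>Inn P\<^esub> s"
    by (rule Inn_gen_inv[OF P]) (simp only: x P.inner_in_Inn)
  ultimately show ?case unfolding e by blast
next
  case (eng g g')
  then obtain h h' where h: "h \<in> carrier (Inn Q)" "compat g h" "h' \<in> carrier (Inn Q)" "compat g' h'" by blast
  have g: "g \<in> carrier (Inn P)" "g' \<in> carrier (Inn P)" using eng(1,2) P.carrier_Inn by simp_all
  have e: "g \<otimes>\<^bsub>Aut P\<^esub> g' = g \<otimes>\<^bsub>Inn P\<^esub> g'" by (simp only: Inn_def mult_subgroup_generated)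
  show ?case unfolding e
    using compat_mult[OF g(1) h(1,2) g(2) h(3,4)]
      monoid.m_closed[OF group.is_monoid[OF Q.group_Inn] h(1,3)] by blast
qed

lemma Inn_map_ex1:
  "\<exists>!h. h \<in> extensional (carrier (Inn P)) \<and> h \<in> epi (Inn P) (Inn Q) \<and>
     (\<forall>x\<in>carrier P. h (inner P x) = inner Q (f x))"
proof -
  define F where "F = (\<lambda>g\<in>carrier (Inn P). SOME h. h \<in> carrier (Inn Q) \<and> compat g h)"
  have F: "F g \<in> carrier (Inn Q)" "compat g (F g)" if "g \<in> carrier (Inn P)" for g
    using someI_ex[of "\<lambda>h. h \<in> carrier (Inn Q) \<and> compat g h"] compat_ex1[OF that] that
    by (auto simp: F_def)
  have Feq: "F g = h" if "g \<in> carrier (Inn P)" "h \<in> carrier (Inn Q)" "compat g h" for g h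
    using compat_unique F that by blast
  interpret IP: group "Inn P" by (rule P.group_Inn)
  interpret IQ: group "Inn Q" by (rule Q.group_Inn)
  have hom: "F \<in> hom (Inn P) (Inn Q)"
  proof (rule homI)
    fix g g' assume g: "g \<in> carrier (Inn P)" "g' \<in> carrier (Inn P)"
    show "F g \<in> carrier (Inn Q)" by (rule F(1)[OF g(1)])
    show "F (g \<otimes>\<^bsub>Inn P\<^esub> g') = F g \<otimes>\<^bsub>Inn Q\<^esub> F g'"
      by (rule Feq[OF IP.m_closed[OF g] IQ.m_closed[OF F(1)[OF g(1)] F(1)[OF g(2)]]
        compat_mult[OF g(1) F[OF g(1)] g(2) F[OF g(2)]]])
  qed
  have gen: "F (inner P x) = inner Q (f x)" if "x \<in> carrier P" for x
    by (rule Feq[OF P.inner_in_Inn[OF that] Q.inner_in_Inn[OF f_props(1)[OF that]] compat_inner[OF that]])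
  have "h \<in> F ` carrier (Inn P)" if "h \<in> carrier (Inn Q)" for h
  proof -
    interpret Fh: group_hom "Inn P" "Inn Q" F
      using hom by unfold_locales
    have "h \<in> generate (Aut Q) (inner Q ` carrier Q)" using that unfolding Q.carrier_Inn .
    then show ?thesis
    proof induction
      case one
      have "\<one>\<^bsub>Aut Q\<^esub> = \<one>\<^bsub>Inn Q\<^esub>" by (simp only: Inn_def one_subgroup_generated)
      then have "\<one>\<^bsub>Aut Q\<^esub> = F \<one>\<^bsub>Inn P\<^esub>" using Fh.hom_one by (simp only:)
      then show ?case using IP.one_closed by blast
    next
      case (incl s)
      from inner_lift[OF this] obtain x where x: "x \<in> carrier P" "s = inner Q (f x)" by blast
      then have "s = F (inner P x)" using gen[OF x(1)] by (simp only:)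
      then show ?case using P.inner_in_Inn[OF x(1)] by blast
    next
      case (inv s)
      from inner_lift[OF this] obtain x where x: "x \<in> carrier P" "s = inner Q (f x)" by blast
      have "inv\<^bsub>Inn Q\<^esub> s = F (inv\<^bsub>Inn P\<^esub> inner P x)"
        unfolding x(2) Fh.hom_inv[OF P.inner_in_Inn[OF x(1)]] gen[OF x(1)] ..
      moreover have "inv\<^bsub>Aut Q\<^esub> s = inv\<^bsub>Inn Q\<^esub> s"
        unfolding x(2) by (rule Inn_gen_inv[OF Q Q.inner_in_Inn[OF f_props(1)[OF x(1)]]])
      ultimately have "inv\<^bsub>Aut Q\<^esub> s = F (inv\<^bsub>Inn P\<^esub> inner P x)" by (simp only:)
      then show ?case using IP.inv_closed[OF P.inner_in_Inn[OF x(1)]] by blast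
    next
      case (eng a b)
      then obtain g g' where "g \<in> carrier (Inn P)" "g' \<in> carrier (Inn P)" "a = F g" "b = F g'" by blast
      moreover have "a \<otimes>\<^bsub>Aut Q\<^esub> b = a \<otimes>\<^bsub>Inn Q\<^esub> b" by (simp only: Inn_def mult_subgroup_generated)
      ultimately have "a \<otimes>\<^bsub>Aut Q\<^esub> b = F (g \<otimes>\<^bsub>Inn P\<^esub> g')" using Fh.hom_mult[of g g'] by (simp only:)
      moreover have "g \<otimes>\<^bsub>Inn P\<^esub> g' \<in> carrier (Inn P)"
        using IP.m_closed \<open>g \<in> carrier (Inn P)\<close> \<open>g' \<in> carrier (Inn P)\<close> by blast
      ultimately show ?case by blast
    qed
  qed
  then have epi: "F \<in> epi (Inn P) (Inn Q)"
    using hom F(1) unfolding epi_def by blast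
  show ?thesis
  proof (rule ex1I[of _ F])
    show "F \<in> extensional (carrier (Inn P)) \<and> F \<in> epi (Inn P) (Inn Q) \<and>
      (\<forall>x\<in>carrier P. F (inner P x) = inner Q (f x))"
    proof (intro conjI ballI)
      show "F \<in> extensional (carrier (Inn P))" unfolding F_def by (rule restrict_extensional)
    qed (fact epi, rule gen)
  next
    fix h assume h: "h \<in> extensional (carrier (Inn P)) \<and> h \<in> epi (Inn P) (Inn Q) \<and>
      (\<forall>x\<in>carrier P. h (inner P x) = inner Q (f x))"
    let ?G = "subgroup_generated (Aut P) (inner P ` carrier P)"
    have IG: "?G = Inn P" unfolding Inn_def ..
    have eq: "h g = F g" if "g \<in> carrier (Inn P)" for g
    proof (rule hom_eq_on_generate[OF P.group_Aut Q.group_Inn, where S = "inner P ` carrier P" and h = h and k = F and x = g])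
      show "inner P ` carrier P \<subseteq> carrier (Aut P)" using P.inner_in_Aut by blast
      have "h \<in> hom (Inn P) (Inn Q)" using h unfolding epi_def by blast
      then show "h \<in> hom ?G (Inn Q)" unfolding IG .
      show "F \<in> hom ?G (Inn Q)" using hom unfolding IG .
      show "h s = F s" if s: "s \<in> inner P ` carrier P" for s
      proof -
        obtain x where x: "x \<in> carrier P" "s = inner P x" using s by blast
        show ?thesis using h gen[OF x(1)] x by (simp only:)
      qed
      show "g \<in> carrier ?G" using that unfolding IG .
    qed
    have e1: "h \<in> extensional (carrier (Inn P))" using h by blast
    have e2: "F \<in> extensional (carrier (Inn P))" unfolding F_def by (rule restrict_extensional)
    show "h = F" by (rule extensionalityI[OF e1 e2 eq])
  qed
qed

end



lemma words_simps [simp]: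
  "[] \<in> words X" "(x, b) # w \<in> words X \<longleftrightarrow> x \<in> X \<and> w \<in> words X"
  "v @ w \<in> words X \<longleftrightarrow> v \<in> words X \<and> w \<in> words X"
  by (auto simp: words_def)

lemma pres_rel_words: "(v, w) \<in> pres_rel X R \<Longrightarrow> v \<in> words X \<and> w \<in> words X"
  by (induction rule: pres_rel.induct) auto

lemma equiv_pres_rel: "equiv (words X) (pres_rel X R)"
proof (rule equivI)
  show "pres_rel X R \<subseteq> words X \<times> words X" by (auto dest: pres_rel_words)
  show "refl_on (words X) (pres_rel X R)"
    unfolding refl_on_def by (blast intro: pres_refl)
  show "Relation.sym (pres_rel X R)" by (rule symI) (rule pres_sym)
  show "Relation.trans (pres_rel X R)" by (rule transI) (rule pres_trans)
qed

lemma pres_rel_append_left: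
  assumes "(v, w) \<in> pres_rel X R" "u \<in> words X"
  shows "(u @ v, u @ w) \<in> pres_rel X R"
  using assms
proof (induction rule: pres_rel.induct)
  case (pres_refl w) then show ?case by (simp add: pres_rel.pres_refl)
next
  case (pres_sym v w) then show ?case by (blast intro: pres_rel.pres_sym)
next
  case (pres_trans a b c) then show ?case by (blast intro: pres_rel.pres_trans)
next
  case (pres_cancel a b x c)
  then show ?case using pres_rel.pres_cancel[of "u @ a" X b x c R] by simp
next
  case (pres_relator a b l r)
  then show ?case using pres_rel.pres_relator[of "u @ a" X b l r R] by simp
qed

lemma pres_rel_append_right:
  assumes "(v, w) \<in> pres_rel X R" "u \<in> words X"
  shows "(v @ u, w @ u) \<in> pres_rel X R"
  using assms
proof (induction rule: pres_rel.induct)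
  case (pres_refl w) then show ?case by (simp add: pres_rel.pres_refl)
next
  case (pres_sym v w) then show ?case by (blast intro: pres_rel.pres_sym)
next
  case (pres_trans a b c) then show ?case by (blast intro: pres_rel.pres_trans)
next
  case (pres_cancel a b x c)
  then show ?case using pres_rel.pres_cancel[of a X "b @ u" x c R] by simp
next
  case (pres_relator a b l r)
  then show ?case using pres_rel.pres_relator[of a X "b @ u" l r R] by simp
qed

lemma pres_rel_append:
  assumes "(v, w) \<in> pres_rel X R" "(v', w') \<in> pres_rel X R"
  shows "(v @ v', w @ w') \<in> pres_rel X R"
proof (rule pres_trans)
  show "(v @ v', w @ v') \<in> pres_rel X R"
    by (rule pres_rel_append_right[OF assms(1)]) (use pres_rel_words[OF assms(2)] in blast)
  show "(w @ v', w @ w') \<in> pres_rel X R"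
    by (rule pres_rel_append_left[OF assms(2)]) (use pres_rel_words[OF assms(1)] in blast)
qed

abbreviation cls :: "'a set \<Rightarrow> ('a word \<times> 'a word) set \<Rightarrow> 'a word \<Rightarrow> 'a word set" where
  "cls X R w \<equiv> pres_rel X R `` {w}"

lemma cls_eq_iff: "v \<in> words X \<Longrightarrow> w \<in> words X \<Longrightarrow> cls X R v = cls X R w \<longleftrightarrow> (v, w) \<in> pres_rel X R"
  using eq_equiv_class_iff[OF equiv_pres_rel] by blast

lemma carrier_presented: "carrier (presented_group X R) = cls X R ` words X"
  by (auto simp: presented_group_def quotient_def)

lemma one_presented: "\<one>\<^bsub>presented_group X R\<^esub> = cls X R []"
  by (simp add: presented_group_def)

lemma mult_presented:
  assumes "v \<in> words X" "w \<in> words X"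
  shows "cls X R v \<otimes>\<^bsub>presented_group X R\<^esub> cls X R w = cls X R (v @ w)"
proof -
  have c: "cls X R (v' @ w') = cls X R (v @ w)" if "v' \<in> cls X R v" "w' \<in> cls X R w" for v' w'
  proof -
    have "(v, v') \<in> pres_rel X R" "(w, w') \<in> pres_rel X R" using that by simp_all
    then show ?thesis by (rule equiv_class_eq[OF equiv_pres_rel pres_rel_append, symmetric])
  qed
  have "(\<Union>v'\<in>cls X R v. \<Union>w'\<in>cls X R w. cls X R (v' @ w')) =
      (\<Union>v'\<in>cls X R v. \<Union>w'\<in>cls X R w. cls X R (v @ w))"
    by (rule SUP_cong[OF refl SUP_cong[OF refl c]])
  moreover have "v \<in> cls X R v" "w \<in> cls X R w" using assms pres_refl by blast+
  ultimately show ?thesis unfolding presented_group_def monoid.simps by blast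
qed

definition winv :: "'a word \<Rightarrow> 'a word" where
  "winv w = rev (map (\<lambda>(x, b). (x, \<not> b)) w)"

lemma winv_simps [simp]: "winv [] = []" "winv ((x, b) # w) = winv w @ [(x, \<not> b)]"
  by (auto simp: winv_def)

lemma winv_words [simp]: "w \<in> words X \<Longrightarrow> winv w \<in> words X"
  by (induction w) auto

lemma winv_cancel: "w \<in> words X \<Longrightarrow> (winv w @ w, []) \<in> pres_rel X R"
proof (induction w)
  case Nil show ?case by (simp add: pres_refl)
next
  case (Cons a w)
  obtain x b where a: "a = (x, b)" by (cases a)
  have "(winv w @ [(x, \<not> b), (x, \<not> \<not> b)] @ w, winv w @ w) \<in> pres_rel X R"
    by (rule pres_cancel) (use Cons.prems a in auto)
  moreover have "(winv w @ w, []) \<in> pres_rel X R" using Cons a by simp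
  ultimately have "(winv w @ [(x, \<not> b), (x, \<not> \<not> b)] @ w, []) \<in> pres_rel X R"
    by (rule pres_trans)
  then show ?case using a by simp
qed

lemma group_presented: "group (presented_group X R)"
proof (rule groupI)
  fix A B assume "A \<in> carrier (presented_group X R)" "B \<in> carrier (presented_group X R)"
  then obtain v w where vw: "v \<in> words X" "w \<in> words X" "A = cls X R v" "B = cls X R w"
    unfolding carrier_presented by blast
  have "v @ w \<in> words X" using vw by simp
  then show "A \<otimes>\<^bsub>presented_group X R\<^esub> B \<in> carrier (presented_group X R)"
    unfolding vw(3,4) mult_presented[OF vw(1,2)] carrier_presented by (rule imageI)
next
  show "\<one>\<^bsub>presented_group X R\<^esub> \<in> carrier (presented_group X R)"
    unfolding one_presented carrier_presented by (rule imageI) simp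
next
  fix A B C assume "A \<in> carrier (presented_group X R)" "B \<in> carrier (presented_group X R)"
    "C \<in> carrier (presented_group X R)"
  then obtain u v w where w: "u \<in> words X" "v \<in> words X" "w \<in> words X"
    "A = cls X R u" "B = cls X R v" "C = cls X R w"
    unfolding carrier_presented by blast
  then show "A \<otimes>\<^bsub>presented_group X R\<^esub> B \<otimes>\<^bsub>presented_group X R\<^esub> C =
    A \<otimes>\<^bsub>presented_group X R\<^esub> (B \<otimes>\<^bsub>presented_group X R\<^esub> C)"
    by (simp add: mult_presented)
next
  fix A assume "A \<in> carrier (presented_group X R)"
  then obtain w where w: "w \<in> words X" "A = cls X R w" unfolding carrier_presented by blast
  then show "\<one>\<^bsub>presented_group X R\<^esub> \<otimes>\<^bsub>presented_group X R\<^esub> A = A"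
    by (simp add: one_presented mult_presented)
  have "cls X R (winv w) \<otimes>\<^bsub>presented_group X R\<^esub> A = cls X R (winv w @ w)"
    unfolding w(2) by (rule mult_presented) (use w in simp_all)
  also have "\<dots> = \<one>\<^bsub>presented_group X R\<^esub>"
    unfolding one_presented by (rule equiv_class_eq[OF equiv_pres_rel winv_cancel[OF w(1)]])
  finally have "cls X R (winv w) \<otimes>\<^bsub>presented_group X R\<^esub> A = \<one>\<^bsub>presented_group X R\<^esub>" .
  moreover have "cls X R (winv w) \<in> carrier (presented_group X R)"
    unfolding carrier_presented by (rule imageI) (use w in simp)
  ultimately show "\<exists>B\<in>carrier (presented_group X R).
    B \<otimes>\<^bsub>presented_group X R\<^esub> A = \<one>\<^bsub>presented_group X R\<^esub>" by blast
qed

definition word_value :: "('b, 'n) monoid_scheme \<Rightarrow> ('a \<Rightarrow> 'b) \<Rightarrow> 'a word \<Rightarrow> 'b" where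
  "word_value H \<phi> w =
     foldr (\<lambda>(x, b) g. (if b then \<phi> x else inv\<^bsub>H\<^esub> \<phi> x) \<otimes>\<^bsub>H\<^esub> g) w \<one>\<^bsub>H\<^esub>"

lemma word_value_simps [simp]:
  "word_value H \<phi> [] = \<one>\<^bsub>H\<^esub>"
  "word_value H \<phi> ((x, b) # w) = (if b then \<phi> x else inv\<^bsub>H\<^esub> \<phi> x) \<otimes>\<^bsub>H\<^esub> word_value H \<phi> w"
  by (simp_all add: word_value_def)

lemma word_value_closed:
  assumes "group H" "\<phi> \<in> X \<rightarrow> carrier H" "w \<in> words X"
  shows "word_value H \<phi> w \<in> carrier H"
proof -
  interpret H: group H by fact
  show ?thesis using assms(3)
  proof (induction w)
    case (Cons a w)
    obtain x b where a: "a = (x, b)" by (cases a)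
    then have "\<phi> x \<in> carrier H" using Cons.prems assms(2) by auto
    then show ?case using Cons a by simp
  qed simp
qed

lemma word_value_append:
  assumes "group H" "\<phi> \<in> X \<rightarrow> carrier H" "v \<in> words X" "w \<in> words X"
  shows "word_value H \<phi> (v @ w) = word_value H \<phi> v \<otimes>\<^bsub>H\<^esub> word_value H \<phi> w"
proof -
  interpret H: group H by fact
  note closed = word_value_closed[OF assms(1,2)]
  show ?thesis using assms(3)
  proof (induction v)
    case Nil
    show ?case using closed[OF assms(4)] by simp
  next
    case (Cons a v)
    obtain x b where a: "a = (x, b)" by (cases a)
    then have "\<phi> x \<in> carrier H" using Cons.prems assms(2) by auto
    then show ?case using Cons a closed[of v] closed[OF assms(4)] by (simp add: H.m_assoc)
  qed
qed

lemma word_value_cong: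
  assumes H: "group H" and \<phi>: "\<phi> \<in> X \<rightarrow> carrier H"
    and R: "\<And>l r. \<lbrakk>(l, r) \<in> R; l \<in> words X; r \<in> words X\<rbrakk> \<Longrightarrow> word_value H \<phi> l = word_value H \<phi> r"
    and "(v, w) \<in> pres_rel X R"
  shows "word_value H \<phi> v = word_value H \<phi> w"
proof -
  interpret H: group H by fact
  note closed = word_value_closed[OF H \<phi>] and app = word_value_append[OF H \<phi>]
  show ?thesis using assms(4)
  proof (induction rule: pres_rel.induct)
    case (pres_cancel u v x b)
    have x: "\<phi> x \<in> carrier H" using pres_cancel \<phi> by blast
    have "word_value H \<phi> [(x, b), (x, \<not> b)] = \<one>\<^bsub>H\<^esub>" using x by simp
    moreover have "[(x, b), (x, \<not> b)] \<in> words X" "[(x, b), (x, \<not> b)] @ v \<in> words X"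
      using pres_cancel by simp_all
    ultimately have "word_value H \<phi> ([(x, b), (x, \<not> b)] @ v) = word_value H \<phi> v"
      using app[of "[(x, b), (x, \<not> b)]" v] closed[of v] pres_cancel
      by (simp only: H.l_one)
    then show ?case
      using app[OF pres_cancel(1) \<open>[(x, b), (x, \<not> b)] @ v \<in> words X\<close>] app[OF pres_cancel(1,2)]
      by (simp only:)
  next
    case (pres_relator u v l r)
    then show ?case using R[of l r] by (simp add: app)
  qed simp_all
qed

theorem presented_group_universal:
  assumes H: "group H" and \<phi>: "\<phi> \<in> X \<rightarrow> carrier H"
    and R: "\<And>l r. \<lbrakk>(l, r) \<in> R; l \<in> words X; r \<in> words X\<rbrakk> \<Longrightarrow> word_value H \<phi> l = word_value H \<phi> r"
  shows "\<exists>!h. h \<in> extensional (carrier (presented_group X R)) \<and> h \<in> hom (presented_group X R) H \<and>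
    (\<forall>x\<in>X. h (cls X R [(x, True)]) = \<phi> x)"
proof -
  let ?G = "presented_group X R"
  interpret G: group ?G by (rule group_presented)
  interpret H: group H by fact
  define F where "F = (\<lambda>A\<in>carrier ?G. word_value H \<phi> (SOME w. w \<in> A))"
  have Fc: "F (cls X R w) = word_value H \<phi> w" if "w \<in> words X" for w
  proof -
    have "w \<in> cls X R w" using that pres_refl by blast
    then have "(SOME v. v \<in> cls X R w) \<in> cls X R w" by (rule someI)
    then have "(w, SOME v. v \<in> cls X R w) \<in> pres_rel X R" by simp
    from word_value_cong[OF H \<phi> R this]
    have "word_value H \<phi> w = word_value H \<phi> (SOME v. v \<in> cls X R w)" .
    moreover have "cls X R w \<in> carrier ?G" unfolding carrier_presented using that by (rule imageI)
    ultimately show ?thesis by (simp add: F_def)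
  qed
  have hom: "F \<in> hom ?G H"
  proof (rule homI)
    fix A assume "A \<in> carrier ?G"
    then obtain w where w: "w \<in> words X" "A = cls X R w" unfolding carrier_presented by blast
    show "F A \<in> carrier H" unfolding w(2) Fc[OF w(1)] by (rule word_value_closed[OF H \<phi> w(1)])
  next
    fix A B assume "A \<in> carrier ?G" "B \<in> carrier ?G"
    then obtain v w where vw: "v \<in> words X" "w \<in> words X" "A = cls X R v" "B = cls X R w"
      unfolding carrier_presented by blast
    have "v @ w \<in> words X" using vw by simp
    then show "F (A \<otimes>\<^bsub>?G\<^esub> B) = F A \<otimes>\<^bsub>H\<^esub> F B"
      unfolding vw(3,4) mult_presented[OF vw(1,2)] Fc[OF vw(1)] Fc[OF vw(2)] Fc
      by (simp only: Fc word_value_append[OF H \<phi> vw(1,2)])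
  qed
  have gen: "F (cls X R [(x, True)]) = \<phi> x" if "x \<in> X" for x
  proof -
    have "\<phi> x \<in> carrier H" using that \<phi> by blast
    then show ?thesis using Fc[of "[(x, True)]"] that by simp
  qed
  show ?thesis
  proof (rule ex1I[of _ F])
    show "F \<in> extensional (carrier ?G) \<and> F \<in> hom ?G H \<and> (\<forall>x\<in>X. F (cls X R [(x, True)]) = \<phi> x)"
    proof (intro conjI ballI)
      show "F \<in> extensional (carrier ?G)" unfolding F_def by (rule restrict_extensional)
    qed (fact hom, rule gen)
  next
    fix h assume h: "h \<in> extensional (carrier ?G) \<and> h \<in> hom ?G H \<and>
      (\<forall>x\<in>X. h (cls X R [(x, True)]) = \<phi> x)"
    then interpret h: group_hom ?G H h by unfold_locales blast
    have letter: "h (cls X R [(x, b)]) = (if b then \<phi> x else inv\<^bsub>H\<^esub> \<phi> x)" if "x \<in> X" for x b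
    proof (cases b)
      case False
      have m: "cls X R [(x, True)] \<in> carrier ?G" "cls X R [(x, False)] \<in> carrier ?G"
        unfolding carrier_presented by (rule imageI, use that in simp)+
      have "cls X R [(x, False)] \<otimes>\<^bsub>?G\<^esub> cls X R [(x, True)] = cls X R ([(x, False)] @ [(x, True)])"
        by (rule mult_presented) (use that in simp_all)
      also have "\<dots> = \<one>\<^bsub>?G\<^esub>"
        unfolding one_presented
        by (rule equiv_class_eq[OF equiv_pres_rel])
          (use pres_cancel[of "[]" X "[]" x False R] that in simp)
      finally have "cls X R [(x, False)] = inv\<^bsub>?G\<^esub> (cls X R [(x, True)])"
        using G.inv_equality m by metis
      then show ?thesis using h.hom_inv[OF m(1)] h that False by auto
    qed (use h that in auto)
    have val: "h (cls X R w) = word_value H \<phi> w" if "w \<in> words X" for w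
      using that
    proof (induction w)
      case Nil
      show ?case using h.hom_one unfolding one_presented by simp
    next
      case (Cons a w)
      obtain x b where a: "a = (x, b)" by (cases a)
      have xw: "[(x, b)] \<in> words X" "w \<in> words X" "x \<in> X" using Cons a by auto
      have m: "cls X R [(x, b)] \<in> carrier ?G" "cls X R w \<in> carrier ?G"
        unfolding carrier_presented by (rule imageI, rule xw)+
      have "h (cls X R (a # w)) = h (cls X R [(x, b)] \<otimes>\<^bsub>?G\<^esub> cls X R w)"
        unfolding mult_presented[OF xw(1,2)] a by simp
      also have "\<dots> = h (cls X R [(x, b)]) \<otimes>\<^bsub>H\<^esub> h (cls X R w)" by (rule h.hom_mult[OF m])
      finally show ?case unfolding a letter[OF xw(3)] using Cons.IH[OF xw(2)] by simp
    qed
    have eq: "h A = F A" if "A \<in> carrier ?G" for A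
    proof -
      obtain w where w: "w \<in> words X" "A = cls X R w" using \<open>A \<in> carrier ?G\<close>
        unfolding carrier_presented by blast
      show ?thesis unfolding w(2) Fc[OF w(1)] by (rule val[OF w(1)])
    qed
    have e1: "h \<in> extensional (carrier ?G)" using h by blast
    have e2: "F \<in> extensional (carrier ?G)" unfolding F_def by (rule restrict_extensional)
    show "h = F" by (rule extensionalityI[OF e1 e2 eq])
  qed
qed

lemma group_Adj: "group (Adj Q)"
  unfolding Adj_def by (rule group_presented)

lemma adj_gen_closed: "x \<in> carrier Q \<Longrightarrow> adj_gen Q x \<in> carrier (Adj Q)"
  unfolding Adj_def adj_gen_def carrier_presented by (rule imageI) simp

lemma adj_gen_rel:
  assumes "quandle Q" "x \<in> carrier Q" "y \<in> carrier Q"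
  shows "adj_gen Q x \<otimes>\<^bsub>Adj Q\<^esub> adj_gen Q y = adj_gen Q (symm Q x y) \<otimes>\<^bsub>Adj Q\<^esub> adj_gen Q x"
proof -
  have s: "symm Q x y \<in> carrier Q" by (rule quandle.symm_closed[OF assms])
  have w: "[(x, True)] \<in> words (carrier Q)" "[(y, True)] \<in> words (carrier Q)"
    "[(symm Q x y, True)] \<in> words (carrier Q)" using assms s by simp_all
  have r: "([(x, True), (y, True)], [(symm Q x y, True), (x, True)]) \<in> Adj_rels Q"
    unfolding Adj_rels_def using assms by simp
  have "([(x, True)] @ [(y, True)], [(symm Q x y, True)] @ [(x, True)])
      \<in> pres_rel (carrier Q) (Adj_rels Q)"
    using pres_rel.pres_relator[of "[]" "carrier Q" "[]", OF words_simps(1) words_simps(1) r] assms s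
    by (simp only: append.simps append_Nil2 words_simps simp_thms)
  from equiv_class_eq[OF equiv_pres_rel this] show ?thesis
    unfolding Adj_def adj_gen_def mult_presented[OF w(1,2)] mult_presented[OF w(3,1)] .
qed

lemma Adj_map_ex1:
  assumes P: "quandle P" and Q: "quandle Q" and f: "f \<in> quandle_hom P Q"
  shows "\<exists>!h. h \<in> extensional (carrier (Adj P)) \<and> h \<in> hom (Adj P) (Adj Q) \<and>
    (\<forall>x\<in>carrier P. h (adj_gen P x) = adj_gen Q (f x))"
  unfolding Adj_def[of P] adj_gen_def[of P]
proof (rule presented_group_universal[OF group_Adj])
  interpret A: group "Adj Q" by (rule group_Adj)
  have f1: "f \<in> carrier P \<rightarrow> carrier Q"
    and f2: "\<forall>x\<in>carrier P. \<forall>y\<in>carrier P. f (symm P x y) = symm Q (f x) (f y)"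
    using f unfolding quandle_hom_def by simp_all
  have fc: "f x \<in> carrier Q" if "x \<in> carrier P" for x
    by (rule funcset_mem[OF f1 that])
  show "(\<lambda>x. adj_gen Q (f x)) \<in> carrier P \<rightarrow> carrier (Adj Q)"
    by (rule funcsetI) (rule adj_gen_closed[OF fc])
  fix l r assume "(l, r) \<in> Adj_rels P"
  then obtain x y where xy: "x \<in> carrier P" "y \<in> carrier P"
    "l = [(x, True), (y, True)]" "r = [(symm P x y, True), (x, True)]"
    unfolding Adj_rels_def by blast
  have fs: "f (symm P x y) = symm Q (f x) (f y)"
    by (rule f2[rule_format, OF xy(1,2)])
  have "symm Q (f x) (f y) \<in> carrier Q"
    by (rule quandle.symm_closed[OF Q fc[OF xy(1)] fc[OF xy(2)]])
  then show "word_value (Adj Q) (\<lambda>x. adj_gen Q (f x)) l = word_value (Adj Q) (\<lambda>x. adj_gen Q (f x)) r"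
    using adj_gen_rel[OF Q fc[OF xy(1)] fc[OF xy(2)]] adj_gen_closed[OF fc[OF xy(1)]]
      adj_gen_closed[OF fc[OF xy(2)]] adj_gen_closed
    unfolding xy(3,4) word_value_simps fs if_True by (simp only: A.r_one)
qed

lemma Inn_map:
  assumes "quandle P" "quandle Q" "f \<in> quandle_epi P Q"
  shows "Inn_map P Q f \<in> epi (Inn P) (Inn Q)"
    and "x \<in> carrier P \<Longrightarrow> Inn_map P Q f (inner P x) = inner Q (f x)"
  using theI'[OF Inn_map_ex1[OF assms]] unfolding Inn_map_def by blast+

lemma Adj_map:
  assumes "quandle P" "quandle Q" "f \<in> quandle_hom P Q"
  shows "Adj_map P Q f \<in> hom (Adj P) (Adj Q)"
    and "x \<in> carrier P \<Longrightarrow> Adj_map P Q f (adj_gen P x) = adj_gen Q (f x)"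
  using theI'[OF Adj_map_ex1[OF assms]] unfolding Adj_map_def by blast+

lemma Inn_rel_normal:
  assumes "quandle P" "quandle Q" "f \<in> quandle_epi P Q"
  shows "Inn_rel P Q f \<lhd> Inn P"
proof -
  have "Inn_map P Q f \<in> hom (Inn P) (Inn Q)" using Inn_map(1)[OF assms] unfolding epi_def by blast
  then have "group_hom (Inn P) (Inn Q) (Inn_map P Q f)"
    using quandle.group_Inn[OF assms(1)] quandle.group_Inn[OF assms(2)]
    by (simp add: group_hom_def group_hom_axioms_def)
  then show ?thesis unfolding Inn_rel_def by (rule group_hom.normal_kernel)
qed

lemma Adj_rel_normal:
  assumes "quandle P" "quandle Q" "f \<in> quandle_hom P Q"
  shows "Adj_rel P Q f \<lhd> Adj P"
proof -
  have "group_hom (Adj P) (Adj Q) (Adj_map P Q f)"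
    using group_Adj[of P] group_Adj[of Q] Adj_map(1)[OF assms]
    by (simp add: group_hom_def group_hom_axioms_def)
  then show ?thesis unfolding Adj_rel_def by (rule group_hom.normal_kernel)
qed

lemma (in quandle) conj_inner:
  assumes g: "g \<in> carrier (Inn Q)" and x: "x \<in> carrier Q"
  shows "g \<otimes>\<^bsub>Inn Q\<^esub> inner Q x \<otimes>\<^bsub>Inn Q\<^esub> inv\<^bsub>Inn Q\<^esub> g = inner Q (g x)"
proof -
  interpret I: group "Inn Q" by (rule group_Inn)
  have gx: "g x \<in> carrier Q" by (rule Bij_mem[OF Inn_Bij[OF g] x])
  note cl = inner_in_Inn[OF x] inner_in_Inn[OF gx]
  have hom: "g (symm Q x y) = symm Q (g x) (g y)" if "y \<in> carrier Q" for y
  proof -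
    have "g \<in> quandle_hom Q Q" using subsetD[OF Inn_subset_Aut g] unfolding quandle_auto_def by blast
    then show ?thesis using x that unfolding quandle_hom_def by simp
  qed
  have "compose (carrier Q) g (inner Q x) = compose (carrier Q) (inner Q (g x)) g"
  proof (rule extensionalityI[of _ "carrier Q"])
    fix y assume y: "y \<in> carrier Q"
    have "g y \<in> carrier Q" by (rule Bij_mem[OF Inn_Bij[OF g] y])
    then show "compose (carrier Q) g (inner Q x) y = compose (carrier Q) (inner Q (g x)) g y"
      using y hom[OF y] by (simp add: compose_eq inner_def)
  qed (rule compose_extensional)+
  then have "g \<otimes>\<^bsub>Inn Q\<^esub> inner Q x = inner Q (g x) \<otimes>\<^bsub>Inn Q\<^esub> g"
    unfolding Inn_mult[OF g cl(1)] Inn_mult[OF cl(2) g] .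
  then show ?thesis using g cl by (simp add: I.m_assoc)
qed

lemma Trans_rel_normal:
  assumes P: "quandle P" and Q: "quandle Q" and f: "f \<in> quandle_epi P Q"
  shows "Trans_rel P f \<lhd> Inn P"
proof -
  interpret P: quandle P by (rule P)
  interpret I: group "Inn P" by (rule P.group_Inn)
  let ?S = "{inner P x \<otimes>\<^bsub>Inn P\<^esub> inv\<^bsub>Inn P\<^esub> inner P y | x y.
        x \<in> carrier P \<and> y \<in> carrier P \<and> f x = f y}"
  show ?thesis unfolding Trans_rel_def
  proof (rule I.normal_generateI)
    show "?S \<subseteq> carrier (Inn P)" using P.inner_in_Inn by auto
  next
    fix h g assume "h \<in> ?S" and g: "g \<in> carrier (Inn P)"
    then obtain x y where xy: "x \<in> carrier P" "y \<in> carrier P" "f x = f y"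
      and h: "h = inner P x \<otimes>\<^bsub>Inn P\<^esub> inv\<^bsub>Inn P\<^esub> inner P y" by blast
    note cl = P.inner_in_Inn[OF xy(1)] P.inner_in_Inn[OF xy(2)]
    have m: "g x \<in> carrier P" "g y \<in> carrier P" using Bij_mem[OF P.Inn_Bij[OF g]] xy by blast+
    obtain k where "compat P f g k" using compat_ex1[OF P Q f g] by blast
    then have "f (g x) = f (g y)" using xy unfolding compat_def[OF P Q f] by metis
    moreover have "g \<otimes>\<^bsub>Inn P\<^esub> h \<otimes>\<^bsub>Inn P\<^esub> inv\<^bsub>Inn P\<^esub> g =
        inner P (g x) \<otimes>\<^bsub>Inn P\<^esub> inv\<^bsub>Inn P\<^esub> inner P (g y)"
    proof -
      have c: "inv\<^bsub>Inn P\<^esub> g \<otimes>\<^bsub>Inn P\<^esub> (g \<otimes>\<^bsub>Inn P\<^esub> z) = z" if "z \<in> carrier (Inn P)" for z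
        using that g by (simp add: I.m_assoc[symmetric])
      show ?thesis
        unfolding P.conj_inner[OF g xy(1), symmetric] P.conj_inner[OF g xy(2), symmetric] h
        using g cl c by (simp add: I.inv_mult_group I.m_assoc)
    qed
    ultimately show "g \<otimes>\<^bsub>Inn P\<^esub> h \<otimes>\<^bsub>Inn P\<^esub> inv\<^bsub>Inn P\<^esub> g \<in> ?S" using m by blast
  qed
qed

end

theory Submission
  imports Defs
begin

text \<open>A normal subgroup \<open>N\<close> of \<open>G\<close> is \<open>G\<close>-hypocentral iff it contains no non-trivial
  \<open>G\<close>-perfect normal subgroup: a perfect subgroup lies in every term of the series, and the series
  becomes stationary at a perfect subgroup. So it suffices to compare perfect subgroups. For the
  transvections, \<open>[Inn P, Inn_rel] \<subseteq> Trans_rel \<subseteq> Inn_rel\<close>. For the adjoint group, the canonical map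
  \<open>\<pi> : Adj P \<rightarrow> Inn P\<close> is surjective with central kernel. Hence a perfect subgroup of \<open>Adj P\<close>
  with trivial image in \<open>Inn P\<close> is trivial, and a perfect \<open>K\<close> in \<open>Inn P\<close> is the image of the
  perfect subgroup \<open>[Adj P, \<pi>\<^sup>-\<^sup>1 K]\<close>. If \<open>K \<subseteq> Inn_rel\<close>, then \<open>\<pi>\<^sup>-\<^sup>1 K\<close> is mapped into the centre of
  \<open>Adj Q\<close>, so that perfect subgroup lies in \<open>Adj_rel\<close>.\<close>

section \<open>Relatively perfect and hypocentral subgroups\<close>

text \<open>The element \<gamma> witnesses that something lies strictly above \<beta>; the least
  such element is the successor. It provides the term of the series directly after a repeated
  value.\<close>

lemma is_pred_suc:
  assumes r: "Well_order r" and "(\<beta>, \<gamma>) \<in> r" "\<beta> \<noteq> \<gamma>"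
  obtains \<sigma> where "is_pred r \<beta> \<sigma>" "(\<sigma>, \<gamma>) \<in> r"
proof -
  interpret wo_rel r using r by (simp add: wo_rel_def)
  let ?\<sigma> = "suc {\<beta>}"
  have F: "{\<beta>} \<subseteq> Field r" using assms(2) by (auto simp: Field_def)
  have \<gamma>: "\<gamma> \<in> AboveS {\<beta>}" using assms(2,3) by (auto simp: AboveS_def Field_def)
  then have A: "AboveS {\<beta>} \<noteq> {}" by blast
  have "\<beta> \<in> underS ?\<sigma>" using suc_greater[OF F A, of \<beta>] by (auto simp: underS_def)
  \<comment> \<open>By totality, a \<delta> not below \<beta> lies strictly above it, so it cannot
    precede the least such element.\<close>
  moreover have "(\<delta>, \<beta>) \<in> r" if "\<delta> \<in> underS ?\<sigma>" for \<delta>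
  proof (rule ccontr)
    assume "(\<delta>, \<beta>) \<notin> r"
    moreover have "\<delta> \<in> Field r" using that by (auto simp: underS_def Field_def)
    ultimately have "\<delta> \<in> AboveS {\<beta>}" using F TOTALS REFL by (auto simp: AboveS_def refl_on_def)
    then have "(?\<sigma>, \<delta>) \<in> r" by (rule suc_least_AboveS)
    then show False using that antisymD[OF ANTISYM, of ?\<sigma> \<delta>] by (auto simp: underS_def)
  qed
  ultimately have "is_pred r \<beta> ?\<sigma>" by (simp add: is_pred_def)
  then show thesis using that suc_least_AboveS[OF \<gamma>] by blast
qed

context group begin

lemma commutator_subgroup_incl:
  assumes "subgroup T G"
    and "\<And>a b. \<lbrakk>a \<in> A; b \<in> B\<rbrakk> \<Longrightarrow> a \<otimes> b \<otimes> inv a \<otimes> inv b \<in> T"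
  shows "commutator_subgroup G A B \<subseteq> T"
  unfolding commutator_subgroup_def by (rule generate_subgroup_incl) (use assms in auto)

lemma commutator_subgroup_mono:
  assumes "A \<subseteq> A'" "B \<subseteq> B'"
  shows "commutator_subgroup G A B \<subseteq> commutator_subgroup G A' B'"
  unfolding commutator_subgroup_def by (rule mono_generate) (use assms in blast)

text \<open>Modulo \<open>T\<close>, the elements commuting with \<open>n\<close> form a subgroup,
  so only generators need checking. The closure is verified by commutator identities, without
  forming the quotient.\<close>

lemma commutator_in_normal_generate:
  assumes T: "T \<lhd> G" and S: "S \<subseteq> carrier G" and n: "n \<in> carrier G"
    and comm: "\<And>s. s \<in> S \<Longrightarrow> s \<otimes> n \<otimes> inv s \<otimes> inv n \<in> T"
    and g: "g \<in> generate G S"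
  shows "g \<otimes> n \<otimes> inv g \<otimes> inv n \<in> T"
proof -
  interpret T: normal T G by (rule T)
  show ?thesis
    using g
  proof induction
    case one
    show ?case using n by simp
  next
    case (incl s)
    then show ?case by (rule comm)
  next
    case (inv s)
    have s: "s \<in> carrier G" using inv S by blast
    \<comment> \<open>The identity is [s\<inverse>, n] = s\<inverse> [s, n]\<inverse> s.\<close>
    have "inv s \<otimes> inv (s \<otimes> n \<otimes> inv s \<otimes> inv n) \<otimes> s \<in> T"
      using T.inv_op_closed1[OF s T.m_inv_closed[OF comm[OF inv]]] .
    moreover have "inv s \<otimes> inv (s \<otimes> n \<otimes> inv s \<otimes> inv n) \<otimes> s
        = inv s \<otimes> n \<otimes> inv (inv s) \<otimes> inv n"
      using s n by (simp add: inv_mult_group m_assoc)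
    ultimately show ?case by simp
  next
    case (eng a b)
    have ab: "a \<in> carrier G" "b \<in> carrier G" using eng generate_incl[OF S] by blast+
    \<comment> \<open>The identity is [ab, n] = (a [b, n] a\<inverse>) [a, n].\<close>
    have "(a \<otimes> (b \<otimes> n \<otimes> inv b \<otimes> inv n) \<otimes> inv a) \<otimes> (a \<otimes> n \<otimes> inv a \<otimes> inv n) \<in> T"
      using T.m_closed[OF T.inv_op_closed2[OF ab(1) eng.IH(2)] eng.IH(1)] .
    moreover have "inv a \<otimes> (a \<otimes> z) = z" "inv n \<otimes> (n \<otimes> z) = z" if "z \<in> carrier G" for z
      using that ab n by (simp_all add: m_assoc[symmetric])
    ultimately show ?case
      using ab n by (simp add: inv_mult_group m_assoc)
  qed
qed

text \<open>Transfinite induction: \<open>K\<close> = [G, K] survives every successor step by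
  monotonicity of commutators, and limit steps are intersections.\<close>

lemma perfect_subset_Gamma:
  assumes r: "Well_order r" and K: "perfect_normal G K" "K \<subseteq> N"
  shows "K \<subseteq> Gamma G N r \<alpha>"
proof -
  interpret wo_rel r using r by (simp add: wo_rel_def)
  show ?thesis
  proof (induction \<alpha> rule: well_order_induct)
    case (1 \<alpha>)
    then have IH: "K \<subseteq> Gamma G N r \<beta>" if "\<beta> \<in> underS \<alpha>" for \<beta>
      using that by (auto simp: underS_def)
    consider "underS \<alpha> = {}" | \<beta> where "is_pred r \<beta> \<alpha>"
      | "underS \<alpha> \<noteq> {}" "\<nexists>\<beta>. is_pred r \<beta> \<alpha>" by blast
    then show ?case
    proof cases
      case 1
      from Gamma_zero[OF r 1, of G N] K(2) show ?thesis by (simp only:)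
    next
      case 2
      then have "\<beta> \<in> underS \<alpha>" by (simp add: is_pred_def)
      from commutator_subgroup_mono[OF order_refl IH[OF this], of "carrier G"]
        Gamma_succ[OF r 2, of G N] K(1)
      show ?thesis unfolding perfect_normal_def by (simp only:)
    next
      case 3
      show ?thesis unfolding Gamma_limit[OF r 3] using IH by (rule INT_greatest)
    qed
  qed
qed

text \<open>The successor term is the commutator of G with the term at \<beta>. It is squeezed
  between the equal terms at \<beta> and \<gamma>, so it equals them.\<close>

lemma Gamma_repeat_perfect:
  assumes r: "Well_order r" and N: "N \<lhd> G" and "(\<beta>, \<gamma>) \<in> r" "\<beta> \<noteq> \<gamma>"
    and eq: "Gamma G N r \<beta> = Gamma G N r \<gamma>"
  shows "perfect_normal G (Gamma G N r \<beta>)"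
proof -
  obtain \<sigma> where \<sigma>: "is_pred r \<beta> \<sigma>" "(\<sigma>, \<gamma>) \<in> r"
    using is_pred_suc[OF r assms(3,4)] .
  from Gamma_antimono[OF r N \<sigma>(2)] Gamma_succ[OF r \<sigma>(1), of G N] eq
  have "Gamma G N r \<beta> \<subseteq> commutator_subgroup G (carrier G) (Gamma G N r \<beta>)" by (simp only:)
  then show ?thesis
    unfolding perfect_normal_def
    using Gamma_normal[OF r N] commutator_subgroup_subset_normal[OF Gamma_normal[OF r N]] by blast
qed

lemma Gamma_subset:
  assumes r: "Well_order r" and N: "N \<lhd> G" and "\<alpha> \<in> Field r"
  shows "Gamma G N r \<alpha> \<subseteq> N"
proof -
  interpret wo_rel r using r by (simp add: wo_rel_def)
  \<comment> \<open>This is the ordinal zero of \<open>r\<close>, where the series takes the value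
    \<open>N\<close>; the rest follows because the series decreases.\<close>
  let ?z = "minim (Field r)"
  have ne: "Field r \<noteq> {}" using assms(3) by blast
  have z: "(?z, \<beta>) \<in> r" if "\<beta> \<in> Field r" for \<beta>
    using minim_least[OF order_refl that] .
  have "\<beta> \<notin> underS ?z" for \<beta>
  proof
    assume "\<beta> \<in> underS ?z"
    then have "(\<beta>, ?z) \<in> r" "\<beta> \<noteq> ?z" by (simp_all add: underS_def)
    then show False using z[of \<beta>] antisymD[OF ANTISYM, of \<beta> ?z] FieldI1[of \<beta> ?z r] by blast
  qed
  then have "underS ?z = {}" by blast
  from Gamma_zero[OF r this, of G N] Gamma_antimono[OF r N z[OF assms(3)]]
  show ?thesis by (simp only:)
qed

text \<open>Well-orders on the type of sets of subsets are long enough for the series to become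
  stationary, since by Cantor's theorem they admit no injective family of subsets.\<close>

theorem hypocentral_iff_no_perfect:
  assumes N: "N \<lhd> G"
  shows "hypocentral G N \<longleftrightarrow> (\<forall>K. perfect_normal G K \<and> K \<subseteq> N \<longrightarrow> K = {\<one>})"
proof (intro iffI allI impI)
  fix K assume "hypocentral G N" and K: "perfect_normal G K \<and> K \<subseteq> N"
  then obtain r :: "'a set rel" and \<alpha> where "Well_order r" "Gamma G N r \<alpha> = {\<one>}"
    unfolding hypocentral_def by blast
  with perfect_subset_Gamma[of r K N \<alpha>] K have "K \<subseteq> {\<one>}" by simp
  moreover have "\<one> \<in> K"
    using K subgroup.one_closed[OF normal_imp_subgroup] unfolding perfect_normal_def by blast
  ultimately show "K = {\<one>}" by blast
next
  assume triv: "\<forall>K. perfect_normal G K \<and> K \<subseteq> N \<longrightarrow> K = {\<one>}"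
  obtain r :: "'a set set rel" where r: "Well_order r" and F: "Field r = UNIV"
    using well_ordering[where ?'a = "'a set set"] by (elim exE conjE)
  have "\<not> inj (Gamma G N r)"
  proof
    assume "inj (Gamma G N r)"
    then have "range (inv_into UNIV (Gamma G N r)) = UNIV" by (rule inj_imp_surj_inv)
    with Cantors_theorem[of "UNIV :: 'a set set"] show False by simp
  qed
  then obtain \<beta> \<gamma> where "\<beta> \<noteq> \<gamma>" "Gamma G N r \<beta> = Gamma G N r \<gamma>" unfolding inj_def by blast
  moreover have "(\<beta>, \<gamma>) \<in> r \<or> (\<gamma>, \<beta>) \<in> r"
    using wo_rel.TOTALS[of r] r F by (simp add: wo_rel_def)
  ultimately obtain \<delta> where "perfect_normal G (Gamma G N r \<delta>)"
    using Gamma_repeat_perfect[OF r N] by metis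
  moreover have "Gamma G N r \<delta> \<subseteq> N" using Gamma_subset[OF r N] F by blast
  ultimately have "Gamma G N r \<delta> = {\<one>}" using triv by blast
  \<comment> \<open>The order \<open>r\<close> lives on a larger type than the one in the definition
    of \<open>hypocentral\<close>; the cited theorem transfers the trivial term to an order on the
    smaller type.\<close>
  then show "hypocentral G N" by (rule hypocentral_if_Gamma_trivial[OF r N, rotated]) (simp add: F)
qed

end

text \<open>Unlike \<open>hom_eq_on_generate\<close>, this takes homomorphisms on the whole of
  \<open>G\<close>, which avoids \<open>subgroup_generated\<close> when two maps on an adjoint group
  are compared.\<close>

lemma group_hom_eq_on_generate:
  assumes h: "group_hom G H h" and k: "group_hom G H k" and S: "S \<subseteq> carrier G"
    and eq: "\<And>s. s \<in> S \<Longrightarrow> h s = k s" and g: "g \<in> generate G S"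
  shows "h g = k g"
proof -
  interpret h: group_hom G H h by (rule h)
  interpret k: group_hom G H k by (rule k)
  show ?thesis
    using g
  proof induction
    case (eng a b)
    have "a \<in> carrier G" "b \<in> carrier G" using eng.hyps h.G.generate_incl[OF S] by blast+
    then show ?case using eng.IH by simp
  qed (use S eq in auto)
qed

section \<open>Perfect subgroups under homomorphisms and central extensions\<close>

context group_hom begin

lemma commutator_subgroup_image:
  assumes "A \<subseteq> carrier G" "B \<subseteq> carrier G"
  shows "h ` commutator_subgroup G A B = commutator_subgroup H (h ` A) (h ` B)"
proof -
  let ?c = "\<lambda>a b. a \<otimes> b \<otimes> inv a \<otimes> inv b"
  let ?S = "{?c a b | a b. a \<in> A \<and> b \<in> B}"
  have c: "h (?c a b) = h a \<otimes>\<^bsub>H\<^esub> h b \<otimes>\<^bsub>H\<^esub> inv\<^bsub>H\<^esub> h a \<otimes>\<^bsub>H\<^esub> inv\<^bsub>H\<^esub> h b"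
    if "a \<in> A" "b \<in> B" for a b
    using that assms by (simp add: subset_iff)
  have "h ` ?S = {a \<otimes>\<^bsub>H\<^esub> b \<otimes>\<^bsub>H\<^esub> inv\<^bsub>H\<^esub> a \<otimes>\<^bsub>H\<^esub> inv\<^bsub>H\<^esub> b | a b. a \<in> h ` A \<and> b \<in> h ` B}"
    (is "_ = ?T")
  proof (intro equalityI subsetI)
    fix y assume "y \<in> h ` ?S"
    then obtain a b where "a \<in> A" "b \<in> B" "y = h (?c a b)" by blast
    then show "y \<in> ?T" using c by blast
  next
    fix y assume "y \<in> ?T"
    then obtain a b where ab: "a \<in> A" "b \<in> B"
      and "y = h a \<otimes>\<^bsub>H\<^esub> h b \<otimes>\<^bsub>H\<^esub> inv\<^bsub>H\<^esub> h a \<otimes>\<^bsub>H\<^esub> inv\<^bsub>H\<^esub> h b" by blast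
    then have "y = h (?c a b)" using c by simp
    then show "y \<in> h ` ?S" using ab by blast
  qed
  moreover have "?S \<subseteq> carrier G" using assms by (auto simp: subset_iff)
  from generate_img[OF this] have "h ` generate G ?S = generate H (h ` ?S)" ..
  ultimately show ?thesis unfolding commutator_subgroup_def by (simp only:)
qed

lemma normal_image:
  assumes surj: "h ` carrier G = carrier H" and K: "K \<lhd> G"
  shows "h ` K \<lhd> H"
proof -
  interpret K: normal K G by (rule K)
  show ?thesis
  proof (rule H.normal_invI)
    show "subgroup (h ` K) H" by (rule subgroup_img_is_subgroup[OF K.subgroup_axioms])
  next
    fix x y assume "x \<in> carrier H" "y \<in> h ` K"
    then obtain g k where gk: "g \<in> carrier G" "x = h g" "k \<in> K" "y = h k"
      using surj by (metis imageE)
    then have "x \<otimes>\<^bsub>H\<^esub> y \<otimes>\<^bsub>H\<^esub> inv\<^bsub>H\<^esub> x = h (g \<otimes> k \<otimes> inv g)"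
      using K.subset by (simp add: subset_iff)
    then show "x \<otimes>\<^bsub>H\<^esub> y \<otimes>\<^bsub>H\<^esub> inv\<^bsub>H\<^esub> x \<in> h ` K" using K.inv_op_closed2 gk by blast
  qed
qed

lemma perfect_normal_image:
  assumes surj: "h ` carrier G = carrier H" and K: "perfect_normal G K"
  shows "perfect_normal H (h ` K)"
proof -
  have n: "K \<lhd> G" and p: "commutator_subgroup G (carrier G) K = K"
    using K unfolding perfect_normal_def by blast+
  have "h ` K = commutator_subgroup H (carrier H) (h ` K)"
    using commutator_subgroup_image[OF order_refl, of K] p surj
      subgroup.subset[OF normal_imp_subgroup[OF n]] by simp
  then show ?thesis using normal_image[OF surj n] unfolding perfect_normal_def by simp
qed

text \<open>Such a \<open>K\<close> lies in the central kernel, so [G, K] is trivial; perfectness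
  identifies it with \<open>K\<close>.\<close>

lemma perfect_trivial_if_image_trivial:
  assumes central: "\<And>z g. \<lbrakk>z \<in> kernel G H h; g \<in> carrier G\<rbrakk> \<Longrightarrow> g \<otimes> z = z \<otimes> g"
    and K: "perfect_normal G K" and triv: "h ` K \<subseteq> {\<one>\<^bsub>H\<^esub>}"
  shows "K = {\<one>}"
proof -
  have n: "K \<lhd> G" and p: "commutator_subgroup G (carrier G) K = K"
    using K unfolding perfect_normal_def by blast+
  interpret K: normal K G by (rule n)
  have "commutator_subgroup G (carrier G) K \<subseteq> {\<one>}"
  proof (rule G.commutator_subgroup_incl[OF G.triv_subgroup])
    fix g k assume g: "g \<in> carrier G" and k: "k \<in> K"
    have kG: "k \<in> carrier G" using k K.subset by blast
    have "k \<in> kernel G H h" using k kG triv by (auto simp: kernel_def)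
    then have "g \<otimes> k = k \<otimes> g" using g by (rule central)
    then show "g \<otimes> k \<otimes> inv g \<otimes> inv k \<in> {\<one>}" using g kG by (simp add: G.m_assoc)
  qed
  then show ?thesis using p K.one_closed by blast
qed

lemma normal_preimage:
  assumes K: "K \<lhd> H"
  shows "{g \<in> carrier G. h g \<in> K} \<lhd> G"
proof -
  interpret K: normal K H by (rule K)
  show ?thesis
  proof (rule G.normal_invI)
    show "subgroup {g \<in> carrier G. h g \<in> K} G"
      by (rule subgroup.intro) auto
  qed (use K.inv_op_closed2 in auto)
qed

text \<open>The full preimage L of \<open>K\<close> contains the whole kernel and may fail to be
  perfect. Since \<open>M\<close> = [G, L] still maps onto \<open>K\<close>, each element of L is an
  element of \<open>M\<close> times a central one. Central factors vanish in commutators, so [G, L]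
  = [G, M].\<close>

lemma perfect_preimage_commutator:
  assumes surj: "h ` carrier G = carrier H"
    and central: "\<And>z g. \<lbrakk>z \<in> kernel G H h; g \<in> carrier G\<rbrakk> \<Longrightarrow> g \<otimes> z = z \<otimes> g"
    and K: "perfect_normal H K"
  defines "M \<equiv> commutator_subgroup G (carrier G) {g \<in> carrier G. h g \<in> K}"
  shows "perfect_normal G M" "h ` M = K"
proof -
  let ?L = "{g \<in> carrier G. h g \<in> K}"
  have n: "K \<lhd> H" and p: "commutator_subgroup H (carrier H) K = K"
    using K unfolding perfect_normal_def by blast+
  have "K \<subseteq> carrier H" by (rule subgroup.subset[OF normal_imp_subgroup[OF n]])
  have "h ` ?L = K"
  proof (intro equalityI subsetI)
    fix k assume "k \<in> K"
    then have "k \<in> h ` carrier G" using \<open>K \<subseteq> carrier H\<close> surj by blast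
    then show "k \<in> h ` ?L" using \<open>k \<in> K\<close> by blast
  qed blast
  then show hM: "h ` M = K"
    unfolding M_def using commutator_subgroup_image[OF order_refl, of ?L] surj p by simp
  have L: "?L \<lhd> G" by (rule normal_preimage[OF n])
  have M: "M \<lhd> G" unfolding M_def by (rule G.commutator_subgroup_normal[OF L])
  have MG: "M \<subseteq> carrier G" by (rule subgroup.subset[OF normal_imp_subgroup[OF M]])
  have "M \<subseteq> commutator_subgroup G (carrier G) M" (is "_ \<subseteq> ?C")
    unfolding M_def
  proof (rule G.commutator_subgroup_incl, unfold M_def[symmetric])
    show "subgroup ?C G" by (rule normal_imp_subgroup[OF G.commutator_subgroup_normal[OF M]])
  next
    fix a l assume a: "a \<in> carrier G" and l: "l \<in> ?L"
    then have "h l \<in> h ` M" using hM by simp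
    then obtain m where m: "m \<in> M" "h l = h m" by blast
    have mG: "m \<in> carrier G" using m MG by blast
    \<comment> \<open>The elements \<open>l\<close> and \<open>m\<close> have the same image, so
      they differ by this central factor.\<close>
    define z where "z = inv m \<otimes> l"
    have z: "z \<in> carrier G" "l = m \<otimes> z" "z \<in> kernel G H h"
      using l mG m(2) by (simp_all add: z_def kernel_def G.m_assoc[symmetric])
    have "a \<otimes> l \<otimes> inv a \<otimes> inv l = a \<otimes> m \<otimes> (z \<otimes> inv a) \<otimes> inv z \<otimes> inv m"
      using a mG z by (simp add: G.m_assoc G.inv_mult_group)
    also have "z \<otimes> inv a = inv a \<otimes> z" using central z a by simp
    also have "a \<otimes> m \<otimes> (inv a \<otimes> z) \<otimes> inv z \<otimes> inv m = a \<otimes> m \<otimes> inv a \<otimes> inv m"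
      using a mG z(1) by (simp add: G.m_assoc)
    finally have "a \<otimes> l \<otimes> inv a \<otimes> inv l = a \<otimes> m \<otimes> inv a \<otimes> inv m" .
    then show "a \<otimes> l \<otimes> inv a \<otimes> inv l \<in> ?C"
      unfolding commutator_subgroup_def using a m(1) by (auto intro: generate.incl)
  qed
  then show "perfect_normal G M"
    unfolding perfect_normal_def using M G.commutator_subgroup_subset_normal[OF M] by blast
qed

end

section \<open>Inner automorphism groups\<close>

text \<open>\<open>Inn Q\<close> is defined by generation inside \<open>Aut Q\<close>; moving the
  generation into \<open>Inn Q\<close> itself allows inductions in its own operations.\<close>

lemma (in quandle) Inn_eq_generate: "carrier (Inn Q) = generate (Inn Q) (inner Q ` carrier Q)"
proof -
  have "carrier (Inn Q) = carrier (subgroup_generated (Inn Q) (inner Q ` carrier Q))"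
    by (simp add: Inn_def group.subgroup_generated2[OF group_Aut])
  also have "\<dots> = generate (Inn Q) (carrier (Inn Q) \<inter> inner Q ` carrier Q)"
    by (rule carrier_subgroup_generated)
  also have "carrier (Inn Q) \<inter> inner Q ` carrier Q = inner Q ` carrier Q"
    using inner_in_Inn by blast
  finally show ?thesis .
qed

lemma (in quandle) Inn_closed: "\<lbrakk>g \<in> carrier (Inn Q); x \<in> carrier Q\<rbrakk> \<Longrightarrow> g x \<in> carrier Q"
  by (rule Bij_mem[OF Inn_Bij])

text \<open>This is \<open>conj_inner\<close> for g = \<open>inner Q x\<close>. It verifies the
  defining relations of \<open>Adj Q\<close> in \<open>Inn Q\<close>.\<close>

lemma (in quandle) inner_mult:
  assumes "x \<in> carrier Q" "y \<in> carrier Q"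
  shows "inner Q x \<otimes>\<^bsub>Inn Q\<^esub> inner Q y = inner Q (symm Q x y) \<otimes>\<^bsub>Inn Q\<^esub> inner Q x"
proof -
  interpret I: group "Inn Q" by (rule group_Inn)
  have "inner Q x \<otimes>\<^bsub>Inn Q\<^esub> inner Q y \<otimes>\<^bsub>Inn Q\<^esub> inv\<^bsub>Inn Q\<^esub> inner Q x = inner Q (symm Q x y)"
    using conj_inner[OF inner_in_Inn[OF assms(1)] assms(2)] assms by (simp add: inner_def)
  then have "inner Q (symm Q x y) \<otimes>\<^bsub>Inn Q\<^esub> inner Q x
      = inner Q x \<otimes>\<^bsub>Inn Q\<^esub> inner Q y \<otimes>\<^bsub>Inn Q\<^esub> inv\<^bsub>Inn Q\<^esub> inner Q x \<otimes>\<^bsub>Inn Q\<^esub> inner Q x"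
    by (simp only:)
  also have "\<dots> = inner Q x \<otimes>\<^bsub>Inn Q\<^esub> inner Q y"
    using inner_in_Inn[OF assms(1)] inner_in_Inn[OF assms(2)] by (simp add: I.m_assoc)
  finally show ?thesis ..
qed

section \<open>The induced map on inner automorphisms and its relative subgroups\<close>

lemma group_hom_Inn_map:
  assumes "quandle P" "quandle Q" "f \<in> quandle_epi P Q"
  shows "group_hom (Inn P) (Inn Q) (Inn_map P Q f)"
  using Inn_map(1)[OF assms] quandle.group_Inn[OF assms(1)] quandle.group_Inn[OF assms(2)]
  by (simp add: epi_def group_hom_def group_hom_axioms_def)

text \<open>\<open>Inn_map\<close> is specified only by its values on generators. Compatibility with
  \<open>f\<close> holds there and passes to products and inverses, which gives the pointwise
  description.\<close>

lemma Inn_map_apply: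
  assumes P: "quandle P" and Q: "quandle Q" and f: "f \<in> quandle_epi P Q"
    and g: "g \<in> carrier (Inn P)" and x: "x \<in> carrier P"
  shows "f (g x) = Inn_map P Q f g (f x)"
proof -
  interpret P: quandle P by (rule P)
  interpret h: group_hom "Inn P" "Inn Q" "Inn_map P Q f" by (rule group_hom_Inn_map[OF P Q f])
  note inner = Inn_map(2)[OF P Q f]
  have "compat P f g (Inn_map P Q f g)"
    using g unfolding P.Inn_eq_generate
  proof induction
    case one
    show ?case using compat_one[OF P Q f] by (simp only: h.hom_one)
  next
    case (incl s)
    then obtain y where "y \<in> carrier P" "s = inner P y" by (rule imageE)
    then show ?case using compat_inner[OF P Q f] inner by (simp only:)
  next
    case (inv s)
    then obtain y where y: "y \<in> carrier P" "s = inner P y" by (rule imageE)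
    have s: "s \<in> carrier (Inn P)" using y P.inner_in_Inn by (simp only:)
    have "compat P f s (Inn_map P Q f s)" using y compat_inner[OF P Q f] inner by (simp only:)
    then show ?case
      using compat_inv[OF P Q f s h.hom_closed[OF s]] by (simp only: h.hom_inv[OF s])
  next
    case (eng a b)
    have ab: "a \<in> carrier (Inn P)" "b \<in> carrier (Inn P)"
      using eng.hyps by (simp_all only: P.Inn_eq_generate)
    show ?case
      unfolding h.hom_mult[OF ab]
      by (rule compat_mult[OF P Q f ab(1) h.hom_closed[OF ab(1)] eng.IH(1)
            ab(2) h.hom_closed[OF ab(2)] eng.IH(2)])
  qed
  then show ?thesis using x unfolding compat_def[OF P Q f] by blast
qed

text \<open>The image of \<open>g\<close> is the identity of \<open>Q\<close>, so \<open>g\<close>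
  can move points only within fibres of \<open>f\<close>.\<close>

lemma Inn_rel_fibre:
  assumes P: "quandle P" and Q: "quandle Q" and f: "f \<in> quandle_epi P Q"
    and g: "g \<in> Inn_rel P Q f" and x: "x \<in> carrier P"
  shows "f (g x) = f x"
proof -
  have gI: "g \<in> carrier (Inn P)" "Inn_map P Q f g = \<one>\<^bsub>Inn Q\<^esub>"
    using g by (simp_all add: Inn_rel_def kernel_def)
  have "f x \<in> carrier Q" by (rule f_props(1)[OF P Q f x])
  then show ?thesis using Inn_map_apply[OF P Q f gI(1) x] gI(2) by (simp add: Inn_def)
qed

text \<open>On a generator, the two factors have mutually inverse images in \<open>Inn Q\<close>
  because \<open>f x = f y\<close>.\<close>

lemma Trans_rel_subset_Inn_rel:
  assumes P: "quandle P" and Q: "quandle Q" and f: "f \<in> quandle_epi P Q"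
  shows "Trans_rel P f \<subseteq> Inn_rel P Q f"
proof -
  interpret P: quandle P by (rule P)
  interpret Q: quandle Q by (rule Q)
  interpret h: group_hom "Inn P" "Inn Q" "Inn_map P Q f" by (rule group_hom_Inn_map[OF P Q f])
  show ?thesis
    unfolding Trans_rel_def Inn_rel_def
  proof (rule h.G.generate_subgroup_incl[OF _ h.subgroup_kernel], rule subsetI)
    fix t assume "t \<in> {inner P x \<otimes>\<^bsub>Inn P\<^esub> inv\<^bsub>Inn P\<^esub> inner P y | x y.
        x \<in> carrier P \<and> y \<in> carrier P \<and> f x = f y}"
    then obtain x y where xy: "x \<in> carrier P" "y \<in> carrier P" "f x = f y"
      and t: "t = inner P x \<otimes>\<^bsub>Inn P\<^esub> inv\<^bsub>Inn P\<^esub> inner P y" by blast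
    have "inner Q (f y) \<in> carrier (Inn Q)" by (rule Q.inner_in_Inn[OF f_props(1)[OF P Q f xy(2)]])
    then show "t \<in> kernel (Inn P) (Inn Q) (Inn_map P Q f)"
      using xy P.inner_in_Inn Inn_map(2)[OF P Q f] by (simp add: t kernel_def)
  qed
qed

text \<open>For s = \<open>inner P x\<close>, the commutator [s, n] is s times the inverse of n s
  n\<inverse> = \<open>inner P (n x)\<close>. Since \<open>n\<close> preserves fibres, this is a
  generator of \<open>Trans_rel\<close>; normality extends the argument from generators to all of
  \<open>Inn P\<close>.\<close>

lemma commutator_Inn_rel_subset_Trans_rel:
  assumes P: "quandle P" and Q: "quandle Q" and f: "f \<in> quandle_epi P Q"
  shows "commutator_subgroup (Inn P) (carrier (Inn P)) (Inn_rel P Q f) \<subseteq> Trans_rel P f"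
proof -
  interpret P: quandle P by (rule P)
  interpret I: group "Inn P" by (rule P.group_Inn)
  have T: "Trans_rel P f \<lhd> Inn P" by (rule Trans_rel_normal[OF P Q f])
  interpret T: subgroup "Trans_rel P f" "Inn P" by (rule normal_imp_subgroup[OF T])
  show ?thesis
  proof (rule I.commutator_subgroup_incl[OF T.subgroup_axioms])
    fix a n assume a: "a \<in> carrier (Inn P)" and n: "n \<in> Inn_rel P Q f"
    have nI: "n \<in> carrier (Inn P)" using n by (simp add: Inn_rel_def kernel_def)
    show "a \<otimes>\<^bsub>Inn P\<^esub> n \<otimes>\<^bsub>Inn P\<^esub> inv\<^bsub>Inn P\<^esub> a \<otimes>\<^bsub>Inn P\<^esub> inv\<^bsub>Inn P\<^esub> n \<in> Trans_rel P f"
    proof (rule I.commutator_in_normal_generate[OF T _ nI])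
      show "inner P ` carrier P \<subseteq> carrier (Inn P)" using P.inner_in_Inn by blast
      show "a \<in> generate (Inn P) (inner P ` carrier P)" using a by (simp only: P.Inn_eq_generate)
    next
      fix s assume "s \<in> inner P ` carrier P"
      then obtain x where x: "x \<in> carrier P" "s = inner P x" by (rule imageE)
      have nx: "n x \<in> carrier P" by (rule P.Inn_closed[OF nI x(1)])
      have s: "s \<in> carrier (Inn P)" using x P.inner_in_Inn by (simp only:)
      have "inner P x \<otimes>\<^bsub>Inn P\<^esub> inv\<^bsub>Inn P\<^esub> inner P (n x) \<in> Trans_rel P f"
        unfolding Trans_rel_def
        using x(1) nx Inn_rel_fibre[OF P Q f n x(1), symmetric] by (blast intro: generate.incl)
      moreover have "inner P (n x) = n \<otimes>\<^bsub>Inn P\<^esub> s \<otimes>\<^bsub>Inn P\<^esub> inv\<^bsub>Inn P\<^esub> n"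
        unfolding x(2) by (rule P.conj_inner[OF nI x(1), symmetric])
      ultimately show "s \<otimes>\<^bsub>Inn P\<^esub> n \<otimes>\<^bsub>Inn P\<^esub> inv\<^bsub>Inn P\<^esub> s \<otimes>\<^bsub>Inn P\<^esub> inv\<^bsub>Inn P\<^esub> n \<in> Trans_rel P f"
        using s nI x(2) by (simp add: I.inv_mult_group I.m_assoc)
    qed
  qed
qed

section \<open>Adjoint groups\<close>

text \<open>A word is the product of its letters, and a letter marked \<open>False\<close> is the
  inverse of a generator.\<close>

lemma presented_eq_generate:
  "carrier (presented_group X R) = generate (presented_group X R) ((\<lambda>x. cls X R [(x, True)]) ` X)"
  (is "carrier ?G = generate ?G ?S")
proof (rule equalityI)
  interpret G: group ?G by (rule group_presented)
  have letter: "cls X R [(x, b)] \<in> carrier ?G" if "x \<in> X" for x b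
    unfolding carrier_presented by (rule imageI) (simp add: that)
  then have "?S \<subseteq> carrier ?G" by blast
  then show "generate ?G ?S \<subseteq> carrier ?G" by (rule G.generate_incl)
  have gen: "cls X R [(x, b)] \<in> generate ?G ?S" if x: "x \<in> X" for x b
  proof (cases b)
    case True
    then show ?thesis using x by (auto intro: generate.incl)
  next
    case False
    have "cls X R [(x, False)] \<otimes>\<^bsub>?G\<^esub> cls X R [(x, True)] = cls X R ([(x, False)] @ [(x, True)])"
      by (rule mult_presented) (simp_all add: x)
    also have "\<dots> = \<one>\<^bsub>?G\<^esub>"
      unfolding one_presented
      by (rule equiv_class_eq[OF equiv_pres_rel])
        (use pres_cancel[of "[]" X "[]" x False R] x in simp)
    finally have "cls X R [(x, False)] = inv\<^bsub>?G\<^esub> (cls X R [(x, True)])"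
      using G.inv_equality letter[OF x] by metis
    also have "\<dots> \<in> generate ?G ?S" by (rule generate.inv) (rule imageI[OF x])
    finally show ?thesis using False by simp
  qed
  have "cls X R w \<in> generate ?G ?S" if "w \<in> words X" for w
    using that
  proof (induction w)
    case Nil
    show ?case using generate.one[of ?G ?S] by (simp only: one_presented)
  next
    case (Cons a w)
    obtain x b where a: "a = (x, b)" by (cases a)
    have w: "x \<in> X" "w \<in> words X" "[(x, b)] \<in> words X" using Cons.prems a by simp_all
    have "cls X R [(x, b)] \<otimes>\<^bsub>?G\<^esub> cls X R w \<in> generate ?G ?S"
      by (rule generate.eng[OF gen[OF w(1)] Cons.IH[OF w(2)]])
    then show ?case unfolding mult_presented[OF w(3,2)] by (simp add: a)
  qed
  then show "carrier ?G \<subseteq> generate ?G ?S" unfolding carrier_presented by blast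
qed

lemma adj_gen_image_closed: "adj_gen Q ` carrier Q \<subseteq> carrier (Adj Q)"
  by (rule image_subsetI) (rule adj_gen_closed)

lemma Adj_eq_generate: "carrier (Adj Q) = generate (Adj Q) (adj_gen Q ` carrier Q)"
  unfolding Adj_def adj_gen_def by (rule presented_eq_generate)

text \<open>The canonical map from the adjoint group to the inner automorphism group. Values outside
  the carrier are left open, so \<open>SOME\<close> takes the place of \<open>THE\<close>.\<close>

definition Adj_Inn :: "('a, 'm) quandle_scheme \<Rightarrow> 'a word set \<Rightarrow> 'a \<Rightarrow> 'a" where
  "Adj_Inn Q = (SOME h. h \<in> hom (Adj Q) (Inn Q) \<and> (\<forall>x\<in>carrier Q. h (adj_gen Q x) = inner Q x))"

section \<open>The canonical action of the adjoint group and its central kernel\<close>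

context quandle begin

text \<open>Existence comes from the universal property of the presentation, with
  \<open>inner_mult\<close> checking the relations.\<close>

lemma Adj_Inn:
  shows Adj_Inn_hom: "Adj_Inn Q \<in> hom (Adj Q) (Inn Q)"
    and Adj_Inn_gen: "x \<in> carrier Q \<Longrightarrow> Adj_Inn Q (adj_gen Q x) = inner Q x"
proof -
  interpret I: group "Inn Q" by (rule group_Inn)
  have "\<exists>!h. h \<in> extensional (carrier (Adj Q)) \<and> h \<in> hom (Adj Q) (Inn Q) \<and>
      (\<forall>x\<in>carrier Q. h (adj_gen Q x) = inner Q x)"
    unfolding Adj_def adj_gen_def
  proof (rule presented_group_universal[OF group_Inn])
    show "inner Q \<in> carrier Q \<rightarrow> carrier (Inn Q)" using inner_in_Inn by blast
    fix l r assume "(l, r) \<in> Adj_rels Q"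
    then obtain x y where xy: "x \<in> carrier Q" "y \<in> carrier Q"
      "l = [(x, True), (y, True)]" "r = [(symm Q x y, True), (x, True)]"
      unfolding Adj_rels_def by blast
    show "word_value (Inn Q) (inner Q) l = word_value (Inn Q) (inner Q) r"
      using inner_mult[OF xy(1,2)] inner_in_Inn[OF xy(1)] inner_in_Inn[OF xy(2)]
      unfolding xy(3,4) by simp
  qed
  then have "\<exists>h. h \<in> hom (Adj Q) (Inn Q) \<and> (\<forall>x\<in>carrier Q. h (adj_gen Q x) = inner Q x)"
    by blast
  from someI_ex[OF this] show "Adj_Inn Q \<in> hom (Adj Q) (Inn Q)"
    and "x \<in> carrier Q \<Longrightarrow> Adj_Inn Q (adj_gen Q x) = inner Q x"
    unfolding Adj_Inn_def by blast+
qed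

sublocale Adj_Inn: group_hom "Adj Q" "Inn Q" "Adj_Inn Q"
  using Adj_Inn_hom group_Adj[of Q] group_Inn by (simp add: group_hom_def group_hom_axioms_def)

lemma Adj_Inn_surj: "Adj_Inn Q ` carrier (Adj Q) = carrier (Inn Q)"
proof -
  from Adj_Inn.generate_img[OF adj_gen_image_closed] have "Adj_Inn Q ` carrier (Adj Q)
      = generate (Inn Q) (Adj_Inn Q ` adj_gen Q ` carrier Q)"
    by (simp only: Adj_eq_generate)
  also have "Adj_Inn Q ` adj_gen Q ` carrier Q = inner Q ` carrier Q"
    unfolding image_image by (rule image_cong[OF refl Adj_Inn_gen])
  finally show ?thesis by (simp only: Inn_eq_generate)
qed

text \<open>For a generator \<open>g\<close> this is a defining relation of \<open>Adj Q\<close>;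
  inverses and products extend it to all \<open>g\<close>. The point \<open>x\<close> is generalized
  because the product case uses the hypothesis for \<open>a\<close> at the point moved by
  \<open>b\<close>.\<close>

lemma conj_adj_gen:
  assumes g: "g \<in> carrier (Adj Q)" and x: "x \<in> carrier Q"
  shows "g \<otimes>\<^bsub>Adj Q\<^esub> adj_gen Q x \<otimes>\<^bsub>Adj Q\<^esub> inv\<^bsub>Adj Q\<^esub> g = adj_gen Q (Adj_Inn Q g x)"
  using g[unfolded Adj_eq_generate] x
proof (induction arbitrary: x)
  case one
  have "Adj_Inn Q \<one>\<^bsub>Adj Q\<^esub> x = x" unfolding Adj_Inn.hom_one using one by (simp add: Inn_def)
  then show ?case using adj_gen_closed[OF one] by simp
next
  case (incl s)
  then obtain y where y: "y \<in> carrier Q" "s = adj_gen Q y" by blast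
  have "Adj_Inn Q s x = symm Q y x" using y Adj_Inn_gen incl.prems by (simp add: inner_def)
  moreover have "s \<otimes>\<^bsub>Adj Q\<^esub> adj_gen Q x = adj_gen Q (symm Q y x) \<otimes>\<^bsub>Adj Q\<^esub> s"
    unfolding y(2) by (rule adj_gen_rel[OF quandle_axioms y(1) incl.prems])
  ultimately show ?case
    using y adj_gen_closed[OF y(1)] adj_gen_closed[OF symm_closed[OF y(1) incl.prems]]
    by (simp add: Adj_Inn.G.m_assoc)
next
  case (inv s)
  then obtain y where y: "y \<in> carrier Q" "s = adj_gen Q y" by blast
  have s: "s \<in> carrier (Adj Q)" unfolding y(2) by (rule adj_gen_closed[OF y(1)])
  \<comment> \<open>The preimage of \<open>x\<close> under \<open>symm Q y\<close>; the relation for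
    \<open>y\<close> and \<open>x'\<close> is then solved for the conjugate by the inverse.\<close>
  define x' where "x' = Adj_Inn Q (inv\<^bsub>Adj Q\<^esub> s) x"
  have inn: "inner Q y \<in> carrier (Inn Q)" by (rule inner_in_Inn[OF y(1)])
  have x'_eq: "x' = (inv\<^bsub>Inn Q\<^esub> inner Q y) x"
    unfolding x'_def Adj_Inn.hom_inv[OF s] unfolding y(2) Adj_Inn_gen[OF y(1)] ..
  have x': "x' \<in> carrier Q"
    unfolding x'_eq using Inn_closed inn inv.prems by simp
  have "symm Q y x' = inner Q y x'" using x' by (simp add: inner_def)
  also have "\<dots> = x" unfolding x'_eq by (rule inv_Inn(2)[OF inn inv.prems])
  finally have "s \<otimes>\<^bsub>Adj Q\<^esub> adj_gen Q x' = adj_gen Q x \<otimes>\<^bsub>Adj Q\<^esub> s"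
    using adj_gen_rel[OF quandle_axioms y(1) x'] y(2) by simp
  then have "inv\<^bsub>Adj Q\<^esub> s \<otimes>\<^bsub>Adj Q\<^esub> (adj_gen Q x \<otimes>\<^bsub>Adj Q\<^esub> s)
      = inv\<^bsub>Adj Q\<^esub> s \<otimes>\<^bsub>Adj Q\<^esub> (s \<otimes>\<^bsub>Adj Q\<^esub> adj_gen Q x')" by simp
  then show ?case
    unfolding x'_def[symmetric]
    using s adj_gen_closed[OF x'] adj_gen_closed[OF inv.prems]
    by (simp add: Adj_Inn.G.m_assoc[symmetric])
next
  case (eng a b)
  have ab: "a \<in> carrier (Adj Q)" "b \<in> carrier (Adj Q)"
    using eng.hyps by (simp_all only: Adj_eq_generate)
  have i: "Adj_Inn Q a \<in> carrier (Inn Q)" "Adj_Inn Q b \<in> carrier (Inn Q)"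
    using ab by simp_all
  have "Adj_Inn Q (a \<otimes>\<^bsub>Adj Q\<^esub> b) x = Adj_Inn Q a (Adj_Inn Q b x)"
    unfolding Adj_Inn.hom_mult[OF ab] Inn_mult[OF i] using eng.prems by (simp add: compose_eq)
  also have "adj_gen Q \<dots>
      = a \<otimes>\<^bsub>Adj Q\<^esub> (b \<otimes>\<^bsub>Adj Q\<^esub> adj_gen Q x \<otimes>\<^bsub>Adj Q\<^esub> inv\<^bsub>Adj Q\<^esub> b) \<otimes>\<^bsub>Adj Q\<^esub> inv\<^bsub>Adj Q\<^esub> a"
    using eng.IH(1)[OF Inn_closed[OF i(2) eng.prems]] eng.IH(2)[OF eng.prems] by simp
  finally show ?case
    using ab adj_gen_closed[OF eng.prems] by (simp add: Adj_Inn.G.inv_mult_group Adj_Inn.G.m_assoc)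
qed

lemma Adj_central_if_commutes_gens:
  assumes z: "z \<in> carrier (Adj Q)"
    and gens: "\<And>x. x \<in> carrier Q \<Longrightarrow> z \<otimes>\<^bsub>Adj Q\<^esub> adj_gen Q x \<otimes>\<^bsub>Adj Q\<^esub> inv\<^bsub>Adj Q\<^esub> z = adj_gen Q x"
    and g: "g \<in> carrier (Adj Q)"
  shows "g \<otimes>\<^bsub>Adj Q\<^esub> z = z \<otimes>\<^bsub>Adj Q\<^esub> g"
proof -
  have "g \<otimes>\<^bsub>Adj Q\<^esub> z \<otimes>\<^bsub>Adj Q\<^esub> inv\<^bsub>Adj Q\<^esub> g \<otimes>\<^bsub>Adj Q\<^esub> inv\<^bsub>Adj Q\<^esub> z \<in> {\<one>\<^bsub>Adj Q\<^esub>}"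
  \<comment> \<open>With the trivial subgroup as \<open>T\<close>, commuting modulo \<open>T\<close>
    is commuting outright.\<close>
  proof (rule Adj_Inn.G.commutator_in_normal_generate[OF Adj_Inn.G.one_is_normal _ z])
    show "adj_gen Q ` carrier Q \<subseteq> carrier (Adj Q)" by (rule adj_gen_image_closed)
    show "g \<in> generate (Adj Q) (adj_gen Q ` carrier Q)" using g by (simp only: Adj_eq_generate)
  next
    fix s assume "s \<in> adj_gen Q ` carrier Q"
    then obtain x where x: "x \<in> carrier Q" "s = adj_gen Q x" by blast
    have s: "s \<in> carrier (Adj Q)" unfolding x(2) by (rule adj_gen_closed[OF x(1)])
    have "s \<otimes>\<^bsub>Adj Q\<^esub> inv\<^bsub>Adj Q\<^esub> (z \<otimes>\<^bsub>Adj Q\<^esub> s \<otimes>\<^bsub>Adj Q\<^esub> inv\<^bsub>Adj Q\<^esub> z) = \<one>\<^bsub>Adj Q\<^esub>"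
      using gens[OF x(1)] s x(2) by simp
    then show "s \<otimes>\<^bsub>Adj Q\<^esub> z \<otimes>\<^bsub>Adj Q\<^esub> inv\<^bsub>Adj Q\<^esub> s \<otimes>\<^bsub>Adj Q\<^esub> inv\<^bsub>Adj Q\<^esub> z \<in> {\<one>\<^bsub>Adj Q\<^esub>}"
      using s z by (simp add: Adj_Inn.G.inv_mult_group Adj_Inn.G.m_assoc)
  qed
  then have "g \<otimes>\<^bsub>Adj Q\<^esub> z \<otimes>\<^bsub>Adj Q\<^esub> inv\<^bsub>Adj Q\<^esub> (z \<otimes>\<^bsub>Adj Q\<^esub> g) = \<one>\<^bsub>Adj Q\<^esub>"
    using g z by (simp add: Adj_Inn.G.inv_mult_group Adj_Inn.G.m_assoc)
  from Adj_Inn.G.inv_equality[OF this] show ?thesis using g z by simp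
qed

text \<open>An element of the kernel acts trivially on \<open>Q\<close>, so by
  \<open>conj_adj_gen\<close> conjugation by it fixes every generator.\<close>

lemma kernel_Adj_Inn_central:
  assumes z: "z \<in> kernel (Adj Q) (Inn Q) (Adj_Inn Q)" and g: "g \<in> carrier (Adj Q)"
  shows "g \<otimes>\<^bsub>Adj Q\<^esub> z = z \<otimes>\<^bsub>Adj Q\<^esub> g"
proof (rule Adj_central_if_commutes_gens[OF _ _ g])
  show zA: "z \<in> carrier (Adj Q)" using z by (simp add: kernel_def)
  fix x assume x: "x \<in> carrier Q"
  have "Adj_Inn Q z x = x" using z x by (simp add: kernel_def Inn_def)
  then show "z \<otimes>\<^bsub>Adj Q\<^esub> adj_gen Q x \<otimes>\<^bsub>Adj Q\<^esub> inv\<^bsub>Adj Q\<^esub> z = adj_gen Q x"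
    using conj_adj_gen[OF zA x] by simp
qed

end

section \<open>Relative adjoint and inner automorphism groups\<close>

context
  fixes P :: "('a, 'm) quandle_scheme" and Q :: "('b, 'n) quandle_scheme" and f :: "'a \<Rightarrow> 'b"
  assumes P: "quandle P" and Q: "quandle Q" and f: "f \<in> quandle_epi P Q"
begin

interpretation P: quandle P by (rule P)
interpretation Q: quandle Q by (rule Q)

lemma quandle_epi_hom: "f \<in> quandle_hom P Q"
  using f by (simp add: quandle_epi_def)

interpretation A: group_hom "Adj P" "Adj Q" "Adj_map P Q f"
  using Adj_map(1)[OF P Q quandle_epi_hom] group_Adj[of P] group_Adj[of Q]
  by (simp add: group_hom_def group_hom_axioms_def)

interpretation I: group_hom "Inn P" "Inn Q" "Inn_map P Q f"
  by (rule group_hom_Inn_map[OF P Q f])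

text \<open>Both composites send \<open>adj_gen P x\<close> to \<open>inner Q (f x)\<close>, and
  these generators determine a homomorphism.\<close>

lemma Adj_Inn_natural:
  assumes "g \<in> carrier (Adj P)"
  shows "Inn_map P Q f (Adj_Inn P g) = Adj_Inn Q (Adj_map P Q f g)"
proof -
  have "group_hom (Adj P) (Inn Q) (Inn_map P Q f \<circ> Adj_Inn P)"
    using hom_compose[OF P.Adj_Inn_hom I.homh] group_Adj[of P] Q.group_Inn
    by (simp add: group_hom_def group_hom_axioms_def)
  moreover have "group_hom (Adj P) (Inn Q) (Adj_Inn Q \<circ> Adj_map P Q f)"
    using hom_compose[OF A.homh Q.Adj_Inn_hom] group_Adj[of P] Q.group_Inn
    by (simp add: group_hom_def group_hom_axioms_def)
  moreover note adj_gen_image_closed[of P]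
  moreover have "(Inn_map P Q f \<circ> Adj_Inn P) s = (Adj_Inn Q \<circ> Adj_map P Q f) s"
    if "s \<in> adj_gen P ` carrier P" for s
  proof -
    from that obtain x where x: "x \<in> carrier P" "s = adj_gen P x" by (rule imageE)
    show ?thesis
      unfolding x(2) comp_def P.Adj_Inn_gen[OF x(1)] Inn_map(2)[OF P Q f x(1)]
        Adj_map(2)[OF P Q quandle_epi_hom x(1)] Q.Adj_Inn_gen[OF f_props(1)[OF P Q f x(1)]] ..
  qed
  moreover have "g \<in> generate (Adj P) (adj_gen P ` carrier P)"
    using assms by (simp only: Adj_eq_generate)
  ultimately have "(Inn_map P Q f \<circ> Adj_Inn P) g = (Adj_Inn Q \<circ> Adj_map P Q f) g"
    by (rule group_hom_eq_on_generate)
  then show ?thesis by (simp only: comp_def)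
qed

lemma Adj_Inn_image_Adj_rel: "Adj_Inn P ` Adj_rel P Q f \<subseteq> Inn_rel P Q f"
proof (rule image_subsetI)
  fix g assume "g \<in> Adj_rel P Q f"
  then have g: "g \<in> carrier (Adj P)" "Adj_map P Q f g = \<one>\<^bsub>Adj Q\<^esub>"
    by (simp_all add: Adj_rel_def kernel_def)
  then show "Adj_Inn P g \<in> Inn_rel P Q f"
    using Adj_Inn_natural[OF g(1)] P.Adj_Inn.hom_closed[OF g(1)] Q.Adj_Inn.hom_one
    by (simp add: Inn_rel_def kernel_def)
qed

text \<open>Conjugation by \<open>l\<close> moves \<open>adj_gen P x\<close> to the generator of
  another point in the same fibre, which \<open>Adj_map\<close> does not distinguish. So the image
  of \<open>l\<close> commutes with \<open>adj_gen Q (f x)\<close>, and surjectivity of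
  \<open>f\<close> reaches all generators of \<open>Adj Q\<close>.\<close>

lemma Adj_map_central:
  assumes l: "l \<in> carrier (Adj P)" "Adj_Inn P l \<in> Inn_rel P Q f" and g: "g \<in> carrier (Adj Q)"
  shows "g \<otimes>\<^bsub>Adj Q\<^esub> Adj_map P Q f l = Adj_map P Q f l \<otimes>\<^bsub>Adj Q\<^esub> g"
proof (rule Q.Adj_central_if_commutes_gens[OF A.hom_closed[OF l(1)] _ g])
  note map = Adj_map(2)[OF P Q quandle_epi_hom]
  fix y assume "y \<in> carrier Q"
  then obtain x where x: "x \<in> carrier P" "y = f x" using f_props(3)[OF P Q f] by (metis imageE)
  have "Adj_Inn P l x \<in> carrier P" by (rule P.Inn_closed[OF P.Adj_Inn.hom_closed[OF l(1)] x(1)])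
  then have "adj_gen Q y = Adj_map P Q f (adj_gen P (Adj_Inn P l x))"
    unfolding map[OF \<open>Adj_Inn P l x \<in> carrier P\<close>] Inn_rel_fibre[OF P Q f l(2) x(1)] x(2) by simp
  also have "\<dots> = Adj_map P Q f (l \<otimes>\<^bsub>Adj P\<^esub> adj_gen P x \<otimes>\<^bsub>Adj P\<^esub> inv\<^bsub>Adj P\<^esub> l)"
    unfolding P.conj_adj_gen[OF l(1) x(1)] ..
  also have "\<dots> = Adj_map P Q f l \<otimes>\<^bsub>Adj Q\<^esub> adj_gen Q y \<otimes>\<^bsub>Adj Q\<^esub> inv\<^bsub>Adj Q\<^esub> Adj_map P Q f l"
    using l(1) adj_gen_closed[OF x(1)] map[OF x(1)] x(2) by simp
  finally show "Adj_map P Q f l \<otimes>\<^bsub>Adj Q\<^esub> adj_gen Q y \<otimes>\<^bsub>Adj Q\<^esub> inv\<^bsub>Adj Q\<^esub> Adj_map P Q f l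
      = adj_gen Q y" ..
qed

text \<open>Both groups contain the same perfect subgroups: a perfect \<open>K\<close> in
  \<open>Inn_rel\<close> equals its commutator with \<open>Inn P\<close>, which falls into
  \<open>Trans_rel\<close>.\<close>

lemma perfect_trivial_Inn_rel_iff_Trans_rel:
  "(\<forall>K. perfect_normal (Inn P) K \<and> K \<subseteq> Inn_rel P Q f \<longrightarrow> K = {\<one>\<^bsub>Inn P\<^esub>}) \<longleftrightarrow>
    (\<forall>K. perfect_normal (Inn P) K \<and> K \<subseteq> Trans_rel P f \<longrightarrow> K = {\<one>\<^bsub>Inn P\<^esub>})"
proof -
  have "K \<subseteq> Trans_rel P f" if K: "perfect_normal (Inn P) K" "K \<subseteq> Inn_rel P Q f" for K
  proof -
    have "K = commutator_subgroup (Inn P) (carrier (Inn P)) K"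
      using K(1) unfolding perfect_normal_def by simp
    also have "\<dots> \<subseteq> commutator_subgroup (Inn P) (carrier (Inn P)) (Inn_rel P Q f)"
      by (rule P.Adj_Inn.commutator_subgroup_mono[OF order_refl K(2)])
    also have "\<dots> \<subseteq> Trans_rel P f" by (rule commutator_Inn_rel_subset_Trans_rel[OF P Q f])
    finally show ?thesis .
  qed
  then show ?thesis using Trans_rel_subset_Inn_rel[OF P Q f] by blast
qed

lemma perfect_trivial_Inn_rel_iff_Adj_rel:
  "(\<forall>K. perfect_normal (Inn P) K \<and> K \<subseteq> Inn_rel P Q f \<longrightarrow> K = {\<one>\<^bsub>Inn P\<^esub>}) \<longleftrightarrow>
    (\<forall>K. perfect_normal (Adj P) K \<and> K \<subseteq> Adj_rel P Q f \<longrightarrow> K = {\<one>\<^bsub>Adj P\<^esub>})"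
proof (intro iffI allI impI; elim conjE)
  fix K assume triv: "\<forall>K. perfect_normal (Inn P) K \<and> K \<subseteq> Inn_rel P Q f \<longrightarrow> K = {\<one>\<^bsub>Inn P\<^esub>}"
    and K: "perfect_normal (Adj P) K" "K \<subseteq> Adj_rel P Q f"
  \<comment> \<open>The image is perfect and hence trivial by hypothesis; centrality of the kernel
    then forces \<open>K\<close> itself to be trivial.\<close>
  have "perfect_normal (Inn P) (Adj_Inn P ` K)"
    by (rule P.Adj_Inn.perfect_normal_image[OF P.Adj_Inn_surj K(1)])
  moreover have "Adj_Inn P ` K \<subseteq> Inn_rel P Q f" using Adj_Inn_image_Adj_rel K(2) by blast
  ultimately have "Adj_Inn P ` K \<subseteq> {\<one>\<^bsub>Inn P\<^esub>}" using triv by blast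
  with P.kernel_Adj_Inn_central K(1) show "K = {\<one>\<^bsub>Adj P\<^esub>}"
    by (rule P.Adj_Inn.perfect_trivial_if_image_trivial)
next
  fix K assume triv: "\<forall>K. perfect_normal (Adj P) K \<and> K \<subseteq> Adj_rel P Q f \<longrightarrow> K = {\<one>\<^bsub>Adj P\<^esub>}"
    and K: "perfect_normal (Inn P) K" "K \<subseteq> Inn_rel P Q f"
  define L where "L = {g \<in> carrier (Adj P). Adj_Inn P g \<in> K}"
  \<comment> \<open>Passing from \<open>L\<close> to its commutator restores perfectness and also
    pushes the subgroup into \<open>Adj_rel\<close>, since elements of \<open>L\<close> become
    central in \<open>Adj Q\<close>.\<close>
  define M where "M = commutator_subgroup (Adj P) (carrier (Adj P)) L"
  have M: "perfect_normal (Adj P) M" "Adj_Inn P ` M = K"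
    unfolding M_def L_def
    using P.Adj_Inn.perfect_preimage_commutator[OF P.Adj_Inn_surj P.kernel_Adj_Inn_central K(1)]
    by simp_all
  have "M \<subseteq> Adj_rel P Q f"
    unfolding M_def Adj_rel_def
  proof (rule P.Adj_Inn.G.commutator_subgroup_incl[OF A.subgroup_kernel])
    fix g l assume g: "g \<in> carrier (Adj P)" and "l \<in> L"
    then have l: "l \<in> carrier (Adj P)" "Adj_Inn P l \<in> Inn_rel P Q f"
      using K(2) by (auto simp: L_def)
    have "Adj_map P Q f g \<otimes>\<^bsub>Adj Q\<^esub> Adj_map P Q f l = Adj_map P Q f l \<otimes>\<^bsub>Adj Q\<^esub> Adj_map P Q f g"
      using Adj_map_central[OF l A.hom_closed[OF g]] .
    then show "g \<otimes>\<^bsub>Adj P\<^esub> l \<otimes>\<^bsub>Adj P\<^esub> inv\<^bsub>Adj P\<^esub> g \<otimes>\<^bsub>Adj P\<^esub> inv\<^bsub>Adj P\<^esub> l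
        \<in> kernel (Adj P) (Adj Q) (Adj_map P Q f)"
      using g l(1) by (simp add: kernel_def Q.Adj_Inn.G.m_assoc)
  qed
  with triv M(1) have "M = {\<one>\<^bsub>Adj P\<^esub>}" by blast
  then show "K = {\<one>\<^bsub>Inn P\<^esub>}" using M(2) P.Adj_Inn.hom_one by simp
qed

end

theorem theorem0p3:
  fixes P :: "'a quandle" and Q :: "'b quandle" and f :: "'a \<Rightarrow> 'b"
  assumes "quandle P" and "quandle Q" and "f \<in> quandle_epi P Q"
  shows "(hypocentral (Inn P) (Inn_rel P Q f) \<longleftrightarrow> hypocentral (Inn P) (Trans_rel P f)) \<and>
    (hypocentral (Inn P) (Inn_rel P Q f) \<longleftrightarrow> hypocentral (Adj P) (Adj_rel P Q f)) \<and>
    (hypocentral (Inn P) (Inn_rel P Q f) \<longleftrightarrow>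
      (\<forall>K. perfect_normal (Inn P) K \<and> K \<subseteq> Inn_rel P Q f \<longrightarrow> K = {\<one>\<^bsub>Inn P\<^esub>}))"
proof -
  note Inn = group.hypocentral_iff_no_perfect[OF quandle.group_Inn[OF assms(1)]]
  have "f \<in> quandle_hom P Q" by (rule quandle_epi_hom[OF assms])
  then have "Adj_rel P Q f \<lhd> Adj P" by (rule Adj_rel_normal[OF assms(1,2)])
  note Adj = group.hypocentral_iff_no_perfect[OF group_Adj this]
  show ?thesis
    \<comment> \<open>Each hypocentrality becomes the absence of non-trivial perfect subgroups. The
      last equivalence is then immediate, and the others are the two comparisons.\<close>
    unfolding Inn[OF Inn_rel_normal[OF assms]] Inn[OF Trans_rel_normal[OF assms]] Adj
    using perfect_trivial_Inn_rel_iff_Trans_rel[OF assms]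
      perfect_trivial_Inn_rel_iff_Adj_rel[OF assms] by blast
qed

end
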